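(* Let $\mathbb{K}$ be an algebraically closed field, $V$ a $\mathbb{K}$-vector space of finite positive dimension, and $\Phi=(A;\{E_i\}_{i=0}^d;A^*;\{E_i^*\}_{i=0}^d)$ a TD system on $V$ of diameter $d\geq 1$ that has $q$-Racah type, with fixed associated scalars $q,a,b$. Let $\psi\in\mathrm{End}(V)$ and the subspaces $U_i,U_i^\Downarrow,W_i$ $(0\le i\le d)$ be as defined in the context. Then for $0\leq i\leq d$, $$U_i=\exp_q\left(\frac{a^{-1}}{q-q^{-1}}\psi\right) W_i,\qquad U_i^\Downarrow=\exp_q\left(\frac{a}{q-q^{-1}}\psi\right) W_i,$$ $$W_i=\exp_{q^{-1}}\left(-\frac{a^{-1}}{q-q^{-1}}\psi\right) U_i,\qquad W_i=\exp_{q^{-1}}\left(-\frac{a}{q-q^{-1}}\psi\right) U_i^\Downarrow.$$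
   Context: TD pair: an ordered pair of linear maps $A,A^*:V\to V$ such that (i) each is diagonalizable; (ii) there is an ordering $\{V_i\}_{i=0}^d$ of the eigenspaces of $A$ with $A^*V_i\subseteq V_{i-1}+V_i+V_{i+1}$ for $0\le i\le d$ ($V_{-1}=V_{d+1}=0$); (iii) there is an ordering $\{V_i^*\}_{i=0}^\delta$ of the eigenspaces of $A^*$ with $AV_i^*\subseteq V_{i-1}^*+V_i^*+V_{i+1}^*$ for $0\le i\le\delta$ ($V^*_{-1}=V^*_{\delta+1}=0$); (iv) no subspace $W$ with $0\ne W\ne V$ satisfies $AW\subseteq W$ and $A^*W\subseteq W$. It is known that $d=\delta$; $d$ is called the diameter. Orderings as in (ii), (iii) are called standard. The primitive idempotent of $A$ for an eigenspace $V_i$ is the projection of $V$ onto $V_i$ that vanishes on the other eigenspaces (similarly for $A^*$). TD system: $(A;\{E_i\}_{i=0}^d;A^*;\{E_i^*\}_{i=0}^d)$ where $A,A^*$ is a TD pair and $\{E_i\}$, $\{E_i^*\}$ are the primitive idempotents of $A$, $A^*$, in orders for which the corresponding eigenspace orderings $\{E_iV\}$, $\{E_i^*V\}$ are standard. Let $\theta_i$ (resp. $\theta_i^*$) be the eigenvalue of $A$ on $E_iV$ (resp. of $A^*$ on $E_i^*V$). $\Phi$ has $q$-Racah type if there are nonzero $q,a,b\in\mathbb{K}$ with $q^4\ne1$ and $\theta_i=aq^{d-2i}+a^{-1}q^{2i-d}$, $\theta_i^*=bq^{d-2i}+b^{-1}q^{2i-d}$ for $0\le i\le d$. (Distinctness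 of eigenvalues forces $q^{2i}\neq1$ for $1\le i\le d$, and $a^2\ne q^{2d-2},q^{2d-4},\dots,q^{2-2d}$; in particular $a^2\neq 1$.) Split decompositions: $U_i=(E_0^*V+\cdots+E_i^*V)\cap(E_iV+\cdots+E_dV)$ and $U_i^\Downarrow=(E_0^*V+\cdots+E_i^*V)\cap(E_0V+\cdots+E_{d-i}V)$ for $0\le i\le d$. It is known that $V=\bigoplus_i U_i=\bigoplus_i U_i^\Downarrow$ with all summands nonzero. $K,B\in\mathrm{End}(V)$ are the linear maps acting on $U_i$, respectively $U_i^\Downarrow$, as the scalar $q^{d-2i}$ ($0\le i\le d$). $\psi\in\mathrm{End}(V)$: $\psi=(I-BK^{-1})\,\bigl(q(aI-a^{-1}BK^{-1})\bigr)^{-1}$ (the inverse is known to exist; it is known that $\psi$ also equals $q(I-K^{-1}B)(aI-a^{-1}K^{-1}B)^{-1}$, $(I-KB^{-1})(q(a^{-1}I-aKB^{-1}))^{-1}$ and $q(I-B^{-1}K)(a^{-1}I-aB^{-1}K)^{-1}$). It is known that $\psi^{d+1}=0$. $\mathcal{M}=\dfrac{aK-a^{-1}B}{a-a^{-1}}\in\mathrm{End}(V)$, and $W_i=\{v\in V:\mathcal{M}v=q^{d-2i}v\}$ is the eigenspace of $\mathcal{M}$ for the eigenvalue $q^{d-2i}$ ($0\le i\le d$). $q$-exponential: $[n]_q=\frac{q^n-q^{-n}}{q-q^{-1}}$, $[n]_q^!=[n]_q[n-1]_q\cdots[1]_q$, $[0]_q^!=1$; for nilpotent $T$, $\exp_q(T)=\sum_{n\ge0}\frac{q^{\binom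 n2}}{[n]_q^!}T^n$ and $\exp_{q^{-1}}(T)=\sum_{n\ge0}\frac{q^{-\binom n2}}{[n]_q^!}T^n$. For $T$ a scalar multiple of $\psi$ the sums run over $0\le n\le d$, since $\psi^{d+1}=0$. *)

theory Defs
  imports "HOL-Computational_Algebra.Polynomial" "HOL-Library.Groups_Big_Fun"
begin

text \<open>
  The vector space V is the whole type \<open>'v\<close>, with scalar multiplication \<open>s\<close>. Sequences indexed
  by \<open>0..d\<close> are functions on \<open>nat\<close> of which only the values at \<open>0..d\<close> are used.
\<close>

definition eigenspace :: "('k::field \<Rightarrow> 'v::ab_group_add \<Rightarrow> 'v) \<Rightarrow> ('v \<Rightarrow> 'v) \<Rightarrow> 'k \<Rightarrow> 'v set" where
  "eigenspace s A \<theta> = {v. A v = s \<theta> v}"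

definition eigenspaces :: "('k::field \<Rightarrow> 'v::ab_group_add \<Rightarrow> 'v) \<Rightarrow> ('v \<Rightarrow> 'v) \<Rightarrow> 'v set set" where
  "eigenspaces s A = {eigenspace s A \<theta> | \<theta>. eigenspace s A \<theta> \<noteq> {0}}"

definition eigenvalue_on :: "('k::field \<Rightarrow> 'v::ab_group_add \<Rightarrow> 'v) \<Rightarrow> ('v \<Rightarrow> 'v) \<Rightarrow> 'v set \<Rightarrow> 'k" where
  "eigenvalue_on s A W = (THE \<theta>. \<forall>v\<in>W. A v = s \<theta> v)"

definition diagonalizable :: "('k::field \<Rightarrow> 'v::ab_group_add \<Rightarrow> 'v) \<Rightarrow> ('v \<Rightarrow> 'v) \<Rightarrow> bool" where
  "diagonalizable s A \<longleftrightarrow> module.span s (\<Union>(eigenspaces s A)) = UNIV"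

definition subspace_sum :: "('k::field \<Rightarrow> 'v::ab_group_add \<Rightarrow> 'v) \<Rightarrow> (nat \<Rightarrow> 'v set) \<Rightarrow> nat set \<Rightarrow> 'v set" where
  "subspace_sum s Vs I = module.span s (\<Union>i\<in>I. Vs i)"

text \<open>
  The index set below is \<open>{i - 1, i, i + 1}\<close> cut down to \<open>0..d\<close>, which accounts for the
  convention that the spaces with index \<open>-1\<close> and \<open>d + 1\<close> are zero.
\<close>

definition standard_ordering ::
    "('k::field \<Rightarrow> 'v::ab_group_add \<Rightarrow> 'v) \<Rightarrow> ('v \<Rightarrow> 'v) \<Rightarrow> ('v \<Rightarrow> 'v) \<Rightarrow> nat \<Rightarrow> (nat \<Rightarrow> 'v set) \<Rightarrow> bool" where
  "standard_ordering s A A' d Vs \<longleftrightarrow>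
     bij_betw Vs {0..d} (eigenspaces s A) \<and>
     (\<forall>i\<le>d. A' ` Vs i \<subseteq> subspace_sum s Vs {j. j \<le> d \<and> i \<le> j + 1 \<and> j \<le> i + 1})"

definition td_pair :: "('k::field \<Rightarrow> 'v::ab_group_add \<Rightarrow> 'v) \<Rightarrow> ('v \<Rightarrow> 'v) \<Rightarrow> ('v \<Rightarrow> 'v) \<Rightarrow> bool" where
  "td_pair s A A' \<longleftrightarrow>
     Vector_Spaces.linear s s A \<and> Vector_Spaces.linear s s A' \<and>
     diagonalizable s A \<and> diagonalizable s A' \<and>
     (\<exists>d Vs. standard_ordering s A A' d Vs) \<and>
     (\<exists>\<delta> Vs'. standard_ordering s A' A \<delta> Vs') \<and>
     \<not> (\<exists>W. module.subspace s W \<and> W \<noteq> {0} \<and> W \<noteq> UNIV \<and> A ` W \<subseteq> W \<and> A' ` W \<subseteq> W)"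

definition primitive_idempotent ::
    "('k::field \<Rightarrow> 'v::ab_group_add \<Rightarrow> 'v) \<Rightarrow> ('v \<Rightarrow> 'v) \<Rightarrow> 'v set \<Rightarrow> ('v \<Rightarrow> 'v) \<Rightarrow> bool" where
  "primitive_idempotent s A W P \<longleftrightarrow>
     W \<in> eigenspaces s A \<and> Vector_Spaces.linear s s P \<and> range P = W \<and> (\<forall>v\<in>W. P v = v) \<and>
     (\<forall>W'\<in>eigenspaces s A. W' \<noteq> W \<longrightarrow> (\<forall>v\<in>W'. P v = 0))"

text \<open>
  TD system \<open>(A; E\<^sub>0, \<dots>, E\<^sub>d; A'; E'\<^sub>0, \<dots>, E'\<^sub>d)\<close>; primes stand for the stars of the usual
  notation, and \<open>E\<^sub>i V\<close> is \<open>range (E i)\<close>.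
\<close>

definition td_system ::
    "('k::field \<Rightarrow> 'v::ab_group_add \<Rightarrow> 'v) \<Rightarrow> nat \<Rightarrow> ('v \<Rightarrow> 'v) \<Rightarrow> (nat \<Rightarrow> 'v \<Rightarrow> 'v) \<Rightarrow>
       ('v \<Rightarrow> 'v) \<Rightarrow> (nat \<Rightarrow> 'v \<Rightarrow> 'v) \<Rightarrow> bool" where
  "td_system s d A E A' E' \<longleftrightarrow>
     td_pair s A A' \<and>
     (\<forall>i\<le>d. primitive_idempotent s A (range (E i)) (E i)) \<and>
     (\<forall>i\<le>d. primitive_idempotent s A' (range (E' i)) (E' i)) \<and>
     standard_ordering s A A' d (\<lambda>i. range (E i)) \<and>
     standard_ordering s A' A d (\<lambda>i. range (E' i))"

definition q_racah ::
    "('k::field \<Rightarrow> 'v::ab_group_add \<Rightarrow> 'v) \<Rightarrow> nat \<Rightarrow> ('v \<Rightarrow> 'v) \<Rightarrow> (nat \<Rightarrow> 'v \<Rightarrow> 'v) \<Rightarrow>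
       ('v \<Rightarrow> 'v) \<Rightarrow> (nat \<Rightarrow> 'v \<Rightarrow> 'v) \<Rightarrow> 'k \<Rightarrow> 'k \<Rightarrow> 'k \<Rightarrow> bool" where
  "q_racah s d A E A' E' q a b \<longleftrightarrow>
     q \<noteq> 0 \<and> a \<noteq> 0 \<and> b \<noteq> 0 \<and> q ^ 4 \<noteq> 1 \<and>
     (\<forall>i\<le>d. eigenvalue_on s A (range (E i)) =
        a * q powi (int d - 2 * int i) + inverse a * q powi (2 * int i - int d)) \<and>
     (\<forall>i\<le>d. eigenvalue_on s A' (range (E' i)) =
        b * q powi (int d - 2 * int i) + inverse b * q powi (2 * int i - int d))"

definition split_U ::
    "('k::field \<Rightarrow> 'v::ab_group_add \<Rightarrow> 'v) \<Rightarrow> nat \<Rightarrow> (nat \<Rightarrow> 'v \<Rightarrow> 'v) \<Rightarrow> (nat \<Rightarrow> 'v \<Rightarrow> 'v) \<Rightarrow> nat \<Rightarrow> 'v set" where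
  "split_U s d E E' i =
     subspace_sum s (\<lambda>j. range (E' j)) {0..i} \<inter> subspace_sum s (\<lambda>j. range (E j)) {i..d}"

definition split_U_Down ::
    "('k::field \<Rightarrow> 'v::ab_group_add \<Rightarrow> 'v) \<Rightarrow> nat \<Rightarrow> (nat \<Rightarrow> 'v \<Rightarrow> 'v) \<Rightarrow> (nat \<Rightarrow> 'v \<Rightarrow> 'v) \<Rightarrow> nat \<Rightarrow> 'v set" where
  "split_U_Down s d E E' i =
     subspace_sum s (\<lambda>j. range (E' j)) {0..i} \<inter> subspace_sum s (\<lambda>j. range (E j)) {0..d - i}"

text \<open>
  The linear map acting on each summand \<open>Us i\<close> as \<open>q\<^bsup>d - 2i\<^esup>\<close>; it is well defined when V is the
  direct sum of \<open>Us 0, \<dots>, Us d\<close>, as is the case for both split decompositions.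
\<close>

definition weight_map ::
    "('k::field \<Rightarrow> 'v::ab_group_add \<Rightarrow> 'v) \<Rightarrow> nat \<Rightarrow> 'k \<Rightarrow> (nat \<Rightarrow> 'v set) \<Rightarrow> 'v \<Rightarrow> 'v" where
  "weight_map s d q Us =
     (THE X. Vector_Spaces.linear s s X \<and>
        (\<forall>i\<le>d. \<forall>v\<in>Us i. X v = s (q powi (int d - 2 * int i)) v))"

definition K_map ::
    "('k::field \<Rightarrow> 'v::ab_group_add \<Rightarrow> 'v) \<Rightarrow> nat \<Rightarrow> (nat \<Rightarrow> 'v \<Rightarrow> 'v) \<Rightarrow> (nat \<Rightarrow> 'v \<Rightarrow> 'v) \<Rightarrow> 'k \<Rightarrow> 'v \<Rightarrow> 'v" where
  "K_map s d E E' q = weight_map s d q (split_U s d E E')"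

definition B_map ::
    "('k::field \<Rightarrow> 'v::ab_group_add \<Rightarrow> 'v) \<Rightarrow> nat \<Rightarrow> (nat \<Rightarrow> 'v \<Rightarrow> 'v) \<Rightarrow> (nat \<Rightarrow> 'v \<Rightarrow> 'v) \<Rightarrow> 'k \<Rightarrow> 'v \<Rightarrow> 'v" where
  "B_map s d E E' q = weight_map s d q (split_U_Down s d E E')"

definition psi_map ::
    "('k::field \<Rightarrow> 'v::ab_group_add \<Rightarrow> 'v) \<Rightarrow> nat \<Rightarrow> (nat \<Rightarrow> 'v \<Rightarrow> 'v) \<Rightarrow> (nat \<Rightarrow> 'v \<Rightarrow> 'v) \<Rightarrow> 'k \<Rightarrow> 'k \<Rightarrow> 'v \<Rightarrow> 'v" where
  "psi_map s d E E' q a =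
     (let BKinv = B_map s d E E' q \<circ> inv (K_map s d E E' q)
      in (\<lambda>v. v - BKinv v) \<circ> inv (\<lambda>v. s q (s a v - s (inverse a) (BKinv v))))"

definition M_map ::
    "('k::field \<Rightarrow> 'v::ab_group_add \<Rightarrow> 'v) \<Rightarrow> nat \<Rightarrow> (nat \<Rightarrow> 'v \<Rightarrow> 'v) \<Rightarrow> (nat \<Rightarrow> 'v \<Rightarrow> 'v) \<Rightarrow> 'k \<Rightarrow> 'k \<Rightarrow> 'v \<Rightarrow> 'v" where
  "M_map s d E E' q a =
     (\<lambda>v. s (inverse (a - inverse a))
        (s a (K_map s d E E' q v) - s (inverse a) (B_map s d E E' q v)))"

definition W_space ::
    "('k::field \<Rightarrow> 'v::ab_group_add \<Rightarrow> 'v) \<Rightarrow> nat \<Rightarrow> (nat \<Rightarrow> 'v \<Rightarrow> 'v) \<Rightarrow> (nat \<Rightarrow> 'v \<Rightarrow> 'v) \<Rightarrow> 'k \<Rightarrow> 'k \<Rightarrow> nat \<Rightarrow> 'v set" where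
  "W_space s d E E' q a i = eigenspace s (M_map s d E E' q a) (q powi (int d - 2 * int i))"

definition q_int :: "'k::field \<Rightarrow> nat \<Rightarrow> 'k" where
  "q_int q n = (q ^ n - inverse q ^ n) / (q - inverse q)"

definition q_fact :: "'k::field \<Rightarrow> nat \<Rightarrow> 'k" where
  "q_fact q n = (\<Prod>k=1..n. q_int q k)"

text \<open>
  For nilpotent \<open>T\<close> only finitely many terms are nonzero, and \<open>Sum_any\<close> is the sum of these.
  A vanishing \<open>q_fact q n\<close> (possible if \<open>q\<close> is a root of unity) does no harm if the power
  \<open>T ^^ n\<close> is zero for such \<open>n\<close>; this is the case for the nilpotent maps of index at most \<open>d + 1\<close>
  considered here, since \<open>q ^ (2 * i) \<noteq> 1\<close> for \<open>1 \<le> i \<le> d\<close>.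
\<close>

definition exp_q :: "('k::field \<Rightarrow> 'v::ab_group_add \<Rightarrow> 'v) \<Rightarrow> 'k \<Rightarrow> ('v \<Rightarrow> 'v) \<Rightarrow> 'v \<Rightarrow> 'v" where
  "exp_q s q T v = Sum_any (\<lambda>n. s (q powi int (n choose 2) / q_fact q n) ((T ^^ n) v))"

definition exp_q_inv :: "('k::field \<Rightarrow> 'v::ab_group_add \<Rightarrow> 'v) \<Rightarrow> 'k \<Rightarrow> ('v \<Rightarrow> 'v) \<Rightarrow> 'v \<Rightarrow> 'v" where
  "exp_q_inv s q T v = Sum_any (\<lambda>n. s (q powi (- int (n choose 2)) / q_fact q n) ((T ^^ n) v))"

end

theory Submission
  imports Defs
begin

text \<open>
  Put \<open>F\<^sub>n = E'\<^sub>0V + \<dots> + E'\<^sub>n\<^sub>-\<^sub>1V\<close>. Let \<open>M\<close> be the map \<open>\<M>\<close> and \<open>N = (K - B) / (a - a\<inverse>)\<close>. Then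
  \<open>N = q \<psi> M\<close>, \<open>K = M - a\<inverse>N = (1 - a\<inverse>q\<psi>) M\<close> and \<open>B = M - aN = (1 - aq\<psi>) M\<close>.

  The heart of the proof is \<open>MN = q\<^sup>2NM\<close>, that is \<open>M\<psi> = q\<^sup>2\<psi>M\<close>. The split decompositions give
  q-commutation relations of \<open>A\<close> and \<open>A'\<close> with \<open>K\<close> and \<open>B\<close>. They imply that for
  \<open>Y = MN - q\<^sup>2NM\<close> both \<open>AY - q\<^sup>4YA\<close> and \<open>A'Y - q\<^sup>-\<^sup>4YA'\<close> are linear combinations of \<open>MY\<close>, \<open>YM\<close>, \<open>NY\<close>,
  \<open>YN\<close>, so the smallest subspace that contains \<open>Y V\<close> and is invariant under \<open>M\<close> and \<open>N\<close> is
  also invariant under \<open>A\<close> and \<open>A'\<close>. It lies in \<open>F\<^sub>d \<noteq> V\<close>, because \<open>M\<close> acts on each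
  \<open>F\<^sub>n\<^sub>+\<^sub>1 / F\<^sub>n\<close> as a scalar and \<open>N\<close> as zero; by irreducibility it is zero.

  Comparing coefficients of powers of \<open>\<psi>\<close>, one then finds \<open>K exp\<^sub>q(c\<psi>) = exp\<^sub>q(c\<psi>) M\<close> and
  \<open>M exp(-c\<psi>) = exp(-c\<psi>) K\<close> (the latter with base \<open>q\<inverse>\<close>) for \<open>c = a\<inverse> / (q - q\<inverse>)\<close>, and likewise for
  \<open>B\<close> with \<open>a\<close> in place of \<open>a\<inverse>\<close>. All these exponentials are bijective, being unipotent on the flag
  \<open>F\<close>, so they map eigenspaces onto eigenspaces.
\<close>

section \<open>Endomorphisms and decompositions of a vector space\<close>

(* Lemmas added to vector_space itself would be shadowed by their instances for real_vector, which is
   interpreted globally; hence a locale of its own. *)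
locale operators = vector_space scale
  for scale :: "'a::field \<Rightarrow> 'b::ab_group_add \<Rightarrow> 'b" (infixr "*s" 75)
begin

abbreviation endo :: "('b \<Rightarrow> 'b) \<Rightarrow> bool" where
  "endo f \<equiv> Vector_Spaces.linear scale scale f"

lemma endo_iff:
  "endo f \<longleftrightarrow> (\<forall>x y. f (x + y) = f x + f y) \<and> (\<forall>c x. f (c *s x) = c *s f x)"
  by (simp add: Vector_Spaces.linear_iff vector_space_axioms)

lemma endoI:
  "(\<And>x y. f (x + y) = f x + f y) \<Longrightarrow> (\<And>c x. f (c *s x) = c *s f x) \<Longrightarrow> endo f"
  by (simp add: endo_iff)

lemma
  assumes "endo f"
  shows endo_add: "f (x + y) = f x + f y"
    and endo_scale: "f (c *s x) = c *s f x"
    and endo_zero: "f 0 = 0"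
    and endo_minus: "f (- x) = - f x"
    and endo_diff: "f (x - y) = f x - f y"
    and endo_sum: "f (sum h I) = (\<Sum>i\<in>I. f (h i))"
proof -
  interpret Vector_Spaces.linear scale scale f by fact
  show "f (x + y) = f x + f y" "f (c *s x) = c *s f x" "f 0 = 0" "f (- x) = - f x"
    "f (x - y) = f x - f y" "f (sum h I) = (\<Sum>i\<in>I. f (h i))"
    by (simp_all add: add scale neg diff sum)
qed

lemmas endo_simps = endo_add endo_scale endo_zero endo_minus endo_diff

lemma endo_shift: "endo f \<Longrightarrow> endo (\<lambda>v. f v - c *s v)"
  by (simp add: endo_iff algebra_simps)

lemma endo_combination: "endo f \<Longrightarrow> endo g \<Longrightarrow> endo (\<lambda>v. x *s f v + y *s g v)"
  by (simp add: endo_iff algebra_simps)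

lemma endo_funpow: "endo f \<Longrightarrow> endo (f ^^ n)"
  by (induction n) (auto simp: endo_iff)

lemma subspace_vimage: "endo f \<Longrightarrow> subspace H \<Longrightarrow> subspace {v. f v \<in> H}"
  by (rule subspaceI)
    (simp_all add: endo_add[of f] endo_scale[of f] endo_zero[of f] subspace_add subspace_scale subspace_0)

lemma endo_span_into:
  assumes "endo f" "subspace H" "\<And>x. x \<in> S \<Longrightarrow> f x \<in> H" "v \<in> span S"
  shows "f v \<in> H"
  using span_induct[OF assms(4), of "\<lambda>v. f v \<in> H"] subspace_vimage[OF assms(1,2)] assms(3)
  by auto

lemma endo_eq_on_span:
  assumes "endo f" "endo g" "span S = UNIV" "\<And>x. x \<in> S \<Longrightarrow> f x = g x"
  shows "f = g"
proof
  fix v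
  have "subspace {v. f v = g v}"
    by (rule subspaceI) (simp_all add: endo_simps[OF assms(1)] endo_simps[OF assms(2)])
  then show "f v = g v"
    using span_induct[of v S "\<lambda>v. f v = g v"] assms by auto
qed

lemma subspace_eigenspace: "endo f \<Longrightarrow> subspace (eigenspace scale f c)"
  by (rule subspaceI)
    (simp_all add: eigenspace_def endo_add[of f] endo_scale[of f] endo_zero[of f] scale_right_distrib
      scale_left_commute)

text \<open>The relation \<open>X T = T Y\<close> makes \<open>X\<close> and \<open>Y\<close>
  conjugate under \<open>T\<close>. All four identities of the theorem are obtained in this form,
  with a q-exponential as \<open>T\<close>.\<close>

lemma eigenspace_intertwine:
  assumes "endo T" "bij T" "\<And>v. X (T v) = T (Y v)"
  shows "eigenspace scale X c = T ` eigenspace scale Y c"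
proof (intro set_eqI iffI)
  fix u assume u: "u \<in> eigenspace scale X c"
  obtain w where w: "u = T w" using assms(2) by (meson bij_pointE)
  have "T (Y w) = T (c *s w)"
    using u w assms(3)[of w] by (simp add: eigenspace_def endo_scale[OF assms(1)])
  then have "Y w = c *s w"
    using assms(2) by (simp add: bij_def inj_eq)
  then show "u \<in> T ` eigenspace scale Y c" using w by (auto simp: eigenspace_def)
next
  fix u assume "u \<in> T ` eigenspace scale Y c"
  then show "u \<in> eigenspace scale X c"
    using assms(3) by (auto simp: eigenspace_def endo_scale[OF assms(1)])
qed

section \<open>Direct sums and maps that are scalar on each summand\<close>

lemma span_UN_atMost_decompose:
  fixes d :: nat
  assumes "\<And>i. i \<le> d \<Longrightarrow> subspace (U i)" "v \<in> span (\<Union>i\<le>d. U i)"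
  shows "\<exists>u. (\<forall>i\<le>d. u i \<in> U i) \<and> v = (\<Sum>i\<le>d. u i)"
  using assms(2)
proof (induction rule: span_induct_alt)
  case base
  show ?case
    using assms(1) by (intro exI[of _ "\<lambda>_. 0"]) (auto simp: subspace_0)
next
  case (step c x y)
  then obtain k u where *: "k \<le> d" "x \<in> U k" "\<forall>i\<le>d. u i \<in> U i" "y = (\<Sum>i\<le>d. u i)"
    by auto
  define w where "w i = (if i = k then c *s x else 0) + u i" for i
  have "(\<Sum>i\<le>d. w i) = c *s x + y"
    using * by (simp add: w_def sum.distrib)
  moreover have "\<forall>i\<le>d. w i \<in> U i"
    using * assms(1) by (auto simp: w_def intro!: subspace_add subspace_scale)
  ultimately show ?case by metis
qed

definition direct_decomposition :: "nat \<Rightarrow> (nat \<Rightarrow> 'b set) \<Rightarrow> bool" where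
  "direct_decomposition d U \<longleftrightarrow>
     (\<forall>i\<le>d. subspace (U i)) \<and> span (\<Union>i\<le>d. U i) = UNIV \<and>
     (\<forall>u. (\<forall>i\<le>d. u i \<in> U i) \<longrightarrow> (\<Sum>i\<le>d. u i) = 0 \<longrightarrow> (\<forall>i\<le>d. u i = 0))"

text \<open>Two decompositions of a vector differ by a decomposition of \<open>0\<close>, so the
  components are unique. Uniqueness makes the component maps linear, since sums and multiples of
  decompositions are again decompositions.\<close>

lemma direct_decomposition_components:
  assumes "direct_decomposition d U"
  obtains P where "\<And>v i. i \<le> d \<Longrightarrow> P i v \<in> U i" "\<And>v. (\<Sum>i\<le>d. P i v) = v"
    "\<And>i. i \<le> d \<Longrightarrow> endo (P i)" "\<And>i j v. i \<le> d \<Longrightarrow> j \<le> d \<Longrightarrow> v \<in> U j \<Longrightarrow> P i v = (if i = j then v else 0)"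
proof -
  have sub: "\<And>i. i \<le> d \<Longrightarrow> subspace (U i)" and span: "span (\<Union>i\<le>d. U i) = UNIV"
    and ind: "\<And>u i. (\<forall>i\<le>d. u i \<in> U i) \<Longrightarrow> (\<Sum>i\<le>d. u i) = 0 \<Longrightarrow> i \<le> d \<Longrightarrow> u i = 0"
    using assms by (auto simp: direct_decomposition_def)
  have "\<forall>v. \<exists>u. (\<forall>i\<le>d. u i \<in> U i) \<and> v = (\<Sum>i\<le>d. u i)"
    using span_UN_atMost_decompose[of d U] sub span by blast
  then obtain u where u: "\<And>v i. i \<le> d \<Longrightarrow> u v i \<in> U i" "\<And>v. (\<Sum>i\<le>d. u v i) = v"
    by metis
  have uniq: "u v i = w i" if w: "\<And>i. i \<le> d \<Longrightarrow> w i \<in> U i" "(\<Sum>i\<le>d. w i) = v" and i: "i \<le> d" for v w i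
  proof -
    have "\<forall>i\<le>d. u v i - w i \<in> U i"
      using u(1) w(1) sub by (blast intro: subspace_diff)
    then show ?thesis
      using ind[of "\<lambda>i. u v i - w i" i] u(2)[of v] w(2) i by (simp add: sum_subtractf)
  qed
  show ?thesis
  proof
    show "u v i \<in> U i" if "i \<le> d" for v i by (rule u) fact
    show "(\<Sum>i\<le>d. u v i) = v" for v by (rule u)
    show "endo (\<lambda>v. u v i)" if "i \<le> d" for i
    proof (rule endoI)
      show "u (x + y) i = u x i + u y i" for x y
        by (rule uniq[where w = "\<lambda>i. u x i + u y i"])
          (auto simp: that sum.distrib u intro!: subspace_add sub)
      show "u (c *s x) i = c *s u x i" for c x
        by (rule uniq[where w = "\<lambda>i. c *s u x i"])
          (auto simp: that u scale_sum_right[symmetric] intro!: subspace_scale sub)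
    qed
    show "u v i = (if i = j then v else 0)" if "i \<le> d" "j \<le> d" "v \<in> U j" for i j v
      by (rule uniq[where w = "\<lambda>i. if i = j then v else 0"])
        (use that in \<open>auto simp: subspace_0 sub\<close>)
  qed
qed

text \<open>Justifies the definite description in \<open>weight_map\<close>. The map is the
  combination of the component projections \<open>P i\<close> with coefficients \<open>c i\<close>;
  uniqueness holds because the summands span.\<close>

lemma weight_map_ex1:
  assumes "direct_decomposition d U"
  shows "\<exists>!X. endo X \<and> (\<forall>i\<le>d. \<forall>v\<in>U i. X v = c i *s v)"
proof (rule ex_ex1I)
  obtain P where P: "\<And>v i. i \<le> d \<Longrightarrow> P i v \<in> U i" "\<And>v. (\<Sum>i\<le>d. P i v) = v"
    "\<And>i. i \<le> d \<Longrightarrow> endo (P i)" "\<And>i j v. i \<le> d \<Longrightarrow> j \<le> d \<Longrightarrow> v \<in> U j \<Longrightarrow> P i v = (if i = j then v else 0)"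
    by (rule direct_decomposition_components[OF assms]) (rule that)
  let ?X = "\<lambda>v. \<Sum>i\<le>d. c i *s P i v"
  have "endo ?X"
    by (rule endoI) (simp_all add: endo_add[OF P(3)] endo_scale[OF P(3)] scale_right_distrib
        sum.distrib scale_sum_right mult.commute)
  moreover have "?X v = c j *s v" if "j \<le> d" "v \<in> U j" for j v
  proof -
    have "?X v = (\<Sum>i\<le>d. if i = j then c j *s v else 0)"
      using that by (intro sum.cong) (auto simp: P(4))
    then show ?thesis using that by simp
  qed
  ultimately show "\<exists>X. endo X \<and> (\<forall>i\<le>d. \<forall>v\<in>U i. X v = c i *s v)" by blast
next
  fix X Y
  assume "endo X \<and> (\<forall>i\<le>d. \<forall>v\<in>U i. X v = c i *s v)" "endo Y \<and> (\<forall>i\<le>d. \<forall>v\<in>U i. Y v = c i *s v)"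
  then show "X = Y"
    using assms by (intro endo_eq_on_span[of X Y "\<Union>i\<le>d. U i"]) (auto simp: direct_decomposition_def)
qed

lemma
  assumes "direct_decomposition d U"
  shows endo_weight_map: "endo (weight_map scale d q U)"
    and weight_map_apply:
      "i \<le> d \<Longrightarrow> v \<in> U i \<Longrightarrow> weight_map scale d q U v = q powi (int d - 2 * int i) *s v"
  using theI'[OF weight_map_ex1[OF assms, of "\<lambda>i. q powi (int d - 2 * int i)"]]
  unfolding weight_map_def by auto

text \<open>Comparing components in \<open>X v = c v\<close> leaves only the component in
  \<open>U i\<close>, provided that no other summand has the same weight.\<close>

lemma eigenspace_weight_map:
  assumes "direct_decomposition d U" "i \<le> d"
    and inj: "\<And>j. j \<le> d \<Longrightarrow> j \<noteq> i \<Longrightarrow> q powi (int d - 2 * int j) \<noteq> q powi (int d - 2 * int i)"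
  shows "eigenspace scale (weight_map scale d q U) (q powi (int d - 2 * int i)) = U i"
proof (intro set_eqI iffI)
  fix v assume "v \<in> U i"
  then show "v \<in> eigenspace scale (weight_map scale d q U) (q powi (int d - 2 * int i))"
    by (simp add: eigenspace_def weight_map_apply assms)
next
  fix v assume v: "v \<in> eigenspace scale (weight_map scale d q U) (q powi (int d - 2 * int i))"
  let ?c = "\<lambda>j. q powi (int d - 2 * int j)"
  let ?X = "weight_map scale d q U"
  have sub: "\<And>i. i \<le> d \<Longrightarrow> subspace (U i)" and span: "span (\<Union>i\<le>d. U i) = UNIV"
    and ind: "\<And>u i. (\<forall>i\<le>d. u i \<in> U i) \<Longrightarrow> (\<Sum>i\<le>d. u i) = 0 \<Longrightarrow> i \<le> d \<Longrightarrow> u i = 0"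
    using assms by (auto simp: direct_decomposition_def)
  obtain u where u: "\<And>i. i \<le> d \<Longrightarrow> u i \<in> U i" "v = (\<Sum>i\<le>d. u i)"
    using span_UN_atMost_decompose[of d U v] sub span by auto
  have "?X v = (\<Sum>j\<le>d. ?c j *s u j)"
    unfolding u(2) endo_sum[OF endo_weight_map[OF assms(1)]]
    by (intro sum.cong) (simp_all add: u(1) weight_map_apply[OF assms(1)])
  then have "(\<Sum>j\<le>d. (?c j - ?c i) *s u j) = 0"
    using v by (simp add: eigenspace_def u scale_left_diff_distrib sum_subtractf scale_sum_right)
  then have "(?c j - ?c i) *s u j = 0" if "j \<le> d" for j
    using ind[of "\<lambda>j. (?c j - ?c i) *s u j" j] that u sub by (simp add: subspace_scale)
  then have "u j = 0" if "j \<le> d" "j \<noteq> i" for j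
    using inj[of j] that by auto
  then have "v = (\<Sum>j\<le>d. if j = i then u i else 0)"
    unfolding u by (intro sum.cong) auto
  then show "v \<in> U i" using u assms by simp
qed

end

section \<open>Operators triangular with respect to a flag\<close>

locale flag = finite_dimensional_vector_space scale Basis + operators scale
  for scale :: "'a::field \<Rightarrow> 'b::ab_group_add \<Rightarrow> 'b" (infixr "*s" 75) and Basis +
  fixes F :: "nat \<Rightarrow> 'b set" and m :: nat
  assumes subspace_F: "subspace (F n)"
    and F_Suc: "F n \<subseteq> F (Suc n)"
    and F_0: "F 0 = {0}"
    and F_top: "F m = UNIV"
begin

lemma F_mono: "n \<le> k \<Longrightarrow> F n \<subseteq> F k"
  by (rule lift_Suc_mono_le[of F]) (rule F_Suc)

lemma F_eq_UNIV: "m \<le> n \<Longrightarrow> F n = UNIV"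
  using F_mono[of m n] F_top by auto

text \<open>Block triangular maps with scalar diagonal blocks: \<open>T\<close> acts on the quotient
  of \<open>F (Suc n)\<close> by \<open>F n\<close> as \<open>c n\<close>. The case
  \<open>c = 0\<close> describes the maps that lower the flag by one step, which are
  nilpotent.\<close>

definition triangular :: "('b \<Rightarrow> 'b) \<Rightarrow> (nat \<Rightarrow> 'a) \<Rightarrow> bool" where
  "triangular T c \<longleftrightarrow> endo T \<and> (\<forall>n<m. \<forall>v\<in>F (Suc n). T v - c n *s v \<in> F n)"

lemma triangularI:
  "endo T \<Longrightarrow> (\<And>n v. n < m \<Longrightarrow> v \<in> F (Suc n) \<Longrightarrow> T v - c n *s v \<in> F n) \<Longrightarrow> triangular T c"
  by (simp add: triangular_def)

lemma triangular_endo: "triangular T c \<Longrightarrow> endo T"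
  by (simp add: triangular_def)

lemma triangularD: "triangular T c \<Longrightarrow> n < m \<Longrightarrow> v \<in> F (Suc n) \<Longrightarrow> T v - c n *s v \<in> F n"
  by (simp add: triangular_def)

lemma triangular_combination:
  assumes "triangular T c" "triangular T' c'"
  shows "triangular (\<lambda>v. x *s T v + y *s T' v) (\<lambda>n. x * c n + y * c' n)"
proof (rule triangularI)
  show "endo (\<lambda>v. x *s T v + y *s T' v)"
    using assms by (intro endo_combination triangular_endo)
  fix n v assume n: "n < m" and v: "v \<in> F (Suc n)"
  have "x *s T v + y *s T' v - (x * c n + y * c' n) *s v
      = x *s (T v - c n *s v) + y *s (T' v - c' n *s v)"
    by (simp add: algebra_simps)
  also have "\<dots> \<in> F n"
    by (intro subspace_add subspace_scale subspace_F triangularD[OF assms(1)]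
        triangularD[OF assms(2)] n v)
  finally show "x *s T v + y *s T' v - (x * c n + y * c' n) *s v \<in> F n" .
qed

text \<open>On each quotient \<open>T\<close> is a nonzero scalar, so a vector of
  \<open>F (Suc n)\<close> whose image lies in \<open>F n\<close> is itself in \<open>F n\<close>.
  Starting from \<open>F m\<close>, the whole space, one descends to \<open>F k\<close>.\<close>

lemma triangular_reflect:
  assumes T: "triangular T c" and c: "\<And>n. n < m \<Longrightarrow> c n \<noteq> 0" and k: "T w \<in> F k"
  shows "w \<in> F k"
proof -
  have "n \<le> m \<Longrightarrow> w \<in> F n \<Longrightarrow> w \<in> F k" for n
  proof (induction n)
    case 0
    then show ?case using F_mono[of 0 k] by auto
  next
    case (Suc n)
    show ?case
    proof (cases "Suc n \<le> k")
      case True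
      then show ?thesis using F_mono Suc.prems by blast
    next
      case False
      then have "T w \<in> F n" using k F_mono[of k n] by auto
      moreover have "T w - c n *s w \<in> F n"
        using Suc.prems by (intro triangularD[OF T]) auto
      ultimately have "T w - (T w - c n *s w) \<in> F n"
        by (rule subspace_diff[OF subspace_F])
      then have "inverse (c n) *s (T w - (T w - c n *s w)) \<in> F n"
        by (intro subspace_scale subspace_F)
      then show ?thesis using c[of n] Suc by simp
    qed
  qed
  then show ?thesis using F_top by blast
qed

lemma triangular_bij:
  assumes T: "triangular T c" and c: "\<And>n. n < m \<Longrightarrow> c n \<noteq> 0"
  shows "bij T"
proof -
  have "inj T"
  proof (rule injI)
    fix x y assume "T x = T y"
    then have "T (x - y) \<in> F 0"
      by (simp add: endo_diff[OF triangular_endo[OF T]] F_0)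
    then have "x - y \<in> F 0" by (rule triangular_reflect[OF T c, rotated])
    then show "x = y" by (simp add: F_0)
  qed
  then show ?thesis
    using linear_inj_imp_surj[OF triangular_endo[OF T]] by (simp add: bij_def)
qed

section \<open>Nilpotent maps and their power series\<close>

lemma lowering_funpow:
  assumes L: "triangular L (\<lambda>_. 0)"
  shows "v \<in> F (n + k) \<Longrightarrow> n + k \<le> m \<Longrightarrow> (L ^^ n) v \<in> F k"
proof (induction n arbitrary: v)
  case (Suc n)
  have "L v \<in> F (n + k)"
    using triangularD[OF L, of "n + k" v] Suc.prems by simp
  then show ?case using Suc by (simp add: funpow_swap1)
qed simp

lemma lowering_nilpotent:
  assumes L: "triangular L (\<lambda>_. 0)" and "m \<le> n"
  shows "(L ^^ n) v = 0"
proof -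
  have "(L ^^ m) ((L ^^ (n - m)) v) \<in> F 0"
    by (rule lowering_funpow[OF L]) (simp_all add: F_top)
  then show ?thesis
    using assms(2) F_0 by (simp flip: funpow_add comp_apply[of "L ^^ m" "L ^^ (n - m)"])
qed

text \<open>The truncation at \<open>m\<close> is exact for lowering maps, whose \<open>m\<close>-th
  power vanishes.\<close>

definition power_series :: "(nat \<Rightarrow> 'a) \<Rightarrow> ('b \<Rightarrow> 'b) \<Rightarrow> 'b \<Rightarrow> 'b" where
  "power_series e L v = (\<Sum>n<m. e n *s (L ^^ n) v)"

lemma triangular_power_series:
  assumes L: "triangular L (\<lambda>_. 0)"
  shows "triangular (power_series e L) (\<lambda>_. e 0)"
proof (rule triangularI)
  have Ln: "endo (L ^^ n)" for n
    by (rule endo_funpow[OF triangular_endo[OF L]])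
  show "endo (power_series e L)"
    unfolding power_series_def
    by (rule endoI) (simp_all add: endo_add[OF Ln] endo_scale[OF Ln] scale_right_distrib
        sum.distrib scale_sum_right mult.commute)
  fix n v assume n: "n < m" and v: "v \<in> F (Suc n)"
  obtain m' where m: "m = Suc m'" using n by (cases m) auto
  have "power_series e L v - e 0 *s v = (\<Sum>k<m'. e (Suc k) *s (L ^^ k) (L v))"
    unfolding power_series_def unfolding m by (simp add: sum.lessThan_Suc_shift funpow_swap1 del: sum.lessThan_Suc)
  also have "\<dots> \<in> F n"
  proof (intro subspace_sum subspace_scale subspace_F)
    fix k
    have Lv: "L v \<in> F n" using triangularD[OF L n v] by simp
    show "(L ^^ k) (L v) \<in> F n"
    proof (induction k)
      case (Suc k)
      then have "L ((L ^^ k) (L v)) - 0 *s (L ^^ k) (L v) \<in> F n"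
        by (intro triangularD[OF L n]) (use F_Suc in auto)
      then show ?case by simp
    qed (simp add: Lv)
  qed
  finally show "power_series e L v - e 0 *s v \<in> F n" .
qed

lemma bij_power_series:
  "triangular L (\<lambda>_. 0) \<Longrightarrow> e 0 \<noteq> 0 \<Longrightarrow> bij (power_series e L)"
  by (rule triangular_bij[OF triangular_power_series])

section \<open>Intertwining by q-exponentials\<close>

context
  fixes L M X :: "'b \<Rightarrow> 'b" and p u :: 'a
  assumes L: "triangular L (\<lambda>_. 0)" and M: "endo M"
    and rel: "\<And>v. M (L v) = p *s L (M v)"
    and X: "\<And>v. X v = M v - u *s L (M v)"
begin

lemma M_funpow: "M ((L ^^ n) v) = p ^ n *s (L ^^ n) (M v)"
  by (induction n) (simp_all add: rel endo_scale[OF triangular_endo[OF L]])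

text \<open>Moving \<open>M\<close> to the right past \<open>L ^^ n\<close> produces
  \<open>p ^ n\<close>, and \<open>X = (1 - u L) M\<close>. The assumption on \<open>e\<close> is
  the comparison of coefficients at \<open>L ^^ Suc n\<close> on both sides.\<close>

lemma X_power_series:
  assumes e: "\<And>n. Suc n < m \<Longrightarrow> e (Suc n) * (p ^ Suc n - 1) = u * e n * p ^ n"
  shows "X (power_series e L v) = power_series e L (M v)"
proof (cases m)
  case 0
  then show ?thesis
    unfolding power_series_def by (simp add: X endo_zero M triangular_endo[OF L])
next
  case (Suc m')
  let ?w = "\<lambda>n. (L ^^ n) (M v)"
  have LE: "endo L" by (rule triangular_endo[OF L])
  have "M (power_series e L v) = (\<Sum>n<m. (e n * p ^ n) *s ?w n)"
    by (simp add: power_series_def endo_sum[OF M] endo_scale[OF M] M_funpow)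
  moreover from this
  have "u *s L (M (power_series e L v)) = (\<Sum>n<m. (u * e n * p ^ n) *s ?w (Suc n))"
    by (simp add: endo_sum[OF LE] endo_scale[OF LE] scale_sum_right mult.assoc)
  ultimately have "X (power_series e L v) =
      (\<Sum>n<m. (e n * p ^ n) *s ?w n) - (\<Sum>n<m. (u * e n * p ^ n) *s ?w (Suc n))"
    by (simp add: X)
  \<comment> \<open>The top term contains \<open>L ^^ m = 0\<close>. Hence the recursion is needed
    only for \<open>Suc n < m\<close>, where the q-factorials do not vanish in the
    application.\<close>
  also have "(\<Sum>n<m. (u * e n * p ^ n) *s ?w (Suc n)) = (\<Sum>n<m'. (u * e n * p ^ n) *s ?w (Suc n))"
    using lowering_nilpotent[OF L, of "Suc m'"] by (simp add: Suc)
  also have "\<dots> = (\<Sum>n<m'. (e (Suc n) * (p ^ Suc n - 1)) *s ?w (Suc n))"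
    using e Suc by (intro sum.cong) (simp_all del: funpow.simps power_Suc)
  finally show ?thesis
    unfolding power_series_def unfolding Suc by (simp add: sum.lessThan_Suc_shift sum_subtractf algebra_simps
        del: sum.lessThan_Suc)
qed

text \<open>Here \<open>L ^^ Suc n\<close> has coefficient \<open>e (Suc n) * p ^ Suc n\<close> on
  the left and \<open>e (Suc n) - u * e n\<close> on the right, which gives the other
  recursion.\<close>

lemma M_power_series:
  assumes e: "\<And>n. Suc n < m \<Longrightarrow> e (Suc n) * (p ^ Suc n - 1) = - (u * e n)"
  shows "M (power_series e L v) = power_series e L (X v)"
proof (cases m)
  case 0
  then show ?thesis unfolding power_series_def by (simp add: endo_zero M)
next
  case (Suc m')
  let ?w = "\<lambda>n. (L ^^ n) (M v)"
  have LE: "endo (L ^^ n)" for n by (rule endo_funpow[OF triangular_endo[OF L]])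
  have "power_series e L (X v) = (\<Sum>n<m. e n *s ?w n) - (\<Sum>n<m. (u * e n) *s ?w (Suc n))"
    by (simp add: power_series_def X endo_diff[OF LE] endo_scale[OF LE] scale_right_diff_distrib
        sum_subtractf funpow_swap1 mult.commute)
  also have "(\<Sum>n<m. (u * e n) *s ?w (Suc n)) = (\<Sum>n<m'. (u * e n) *s ?w (Suc n))"
    using lowering_nilpotent[OF L, of "Suc m'"] by (simp add: Suc)
  also have "\<dots> = (\<Sum>n<m'. (- (e (Suc n) * (p ^ Suc n - 1))) *s ?w (Suc n))"
    using e Suc by (intro sum.cong) (simp_all del: funpow.simps power_Suc)
  finally have "power_series e L (X v) = (\<Sum>n<m. (e n * p ^ n) *s ?w n)"
    by (simp add: Suc sum.lessThan_Suc_shift sum_subtractf sum_negf algebra_simps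
        del: sum.lessThan_Suc)
  then show ?thesis
    by (simp add: power_series_def endo_sum[OF M] endo_scale[OF M] M_funpow)
qed

end

section \<open>The coefficients of the q-exponentials\<close>

lemma scaled_funpow:
  assumes "endo L"
  shows "((\<lambda>v. c *s L v) ^^ n) v = c ^ n *s (L ^^ n) v"
  by (induction n) (simp_all add: endo_scale[OF assms])

lemma Sum_any_power_series:
  assumes L: "triangular L (\<lambda>_. 0)"
  shows "Sum_any (\<lambda>n. g n *s ((\<lambda>v. c *s L v) ^^ n) v) = power_series (\<lambda>n. g n * c ^ n) L v"
  unfolding scaled_funpow[OF triangular_endo[OF L]] power_series_def
  by (subst Sum_any.expand_superset[of "{..<m}"])
    (use lowering_nilpotent[OF L] in \<open>auto simp: not_less[symmetric]\<close>)

lemma choose_two_Suc: "Suc n choose 2 = n + (n choose 2)"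
  by (simp add: numeral_2_eq_2)

text \<open>With \<open>x = q ^ Suc n\<close>, both the q-integer and
  \<open>(q ^ 2) ^ Suc n - 1 = x * (x - inverse x)\<close> contain the factor
  \<open>x - inverse x\<close>, which cancels.\<close>

lemma q_int_Suc_ratio:
  fixes q t :: 'a
  assumes "q \<noteq> 0" "q ^ 2 \<noteq> 1" "(q ^ 2) ^ Suc n \<noteq> 1"
  shows "q_int q (Suc n) \<noteq> 0"
    and "t / (q - inverse q) / q_int q (Suc n) * ((q ^ 2) ^ Suc n - 1) = t * q ^ Suc n"
proof -
  define x where "x = q ^ Suc n"
  have x: "x \<noteq> 0" "x ^ 2 \<noteq> 1" using assms
    by (auto simp: x_def power_mult[symmetric] mult.commute simp del: power_Suc)
  have i: "q_int q (Suc n) = (x - inverse x) / (q - inverse q)"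
    by (simp add: q_int_def x_def power_inverse)
  have q1: "q - inverse q \<noteq> 0"
    using assms(1,2) by (simp add: field_simps power2_eq_square)
  have x1: "x - inverse x \<noteq> 0"
    using x by (simp add: field_simps power2_eq_square)
  have x2: "(q ^ 2) ^ Suc n = x ^ 2"
    by (simp add: x_def power_mult[symmetric] mult.commute del: power_Suc)
  show "q_int q (Suc n) \<noteq> 0" using q1 x1 by (simp add: i)
  have "x ^ 2 - 1 = x * (x - inverse x)"
    using x(1) by (simp add: algebra_simps power2_eq_square)
  then show "t / (q - inverse q) / q_int q (Suc n) * ((q ^ 2) ^ Suc n - 1) = t * q ^ Suc n"
    unfolding i x2 x_def[symmetric] using q1 x1 by simp
qed

text \<open>The coefficients of the two q-exponentials solve the two recursions with
  \<open>p = q ^ 2\<close> and \<open>u = t * q\<close>. The lemma is applied to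
  \<open>\<psi>\<close> as \<open>L\<close>, once with \<open>K\<close> as \<open>X\<close> and
  \<open>t = inverse a\<close>, once with \<open>B\<close> as \<open>X\<close> and
  \<open>t = a\<close>.\<close>

lemma q_exponential_eigenspaces:
  assumes L: "triangular L (\<lambda>_. 0)" and M: "endo M"
    and rel: "\<And>v. M (L v) = q ^ 2 *s L (M v)"
    and X: "\<And>v. X v = M v - (t * q) *s L (M v)"
    and q: "q \<noteq> 0" "\<And>k. 0 < k \<Longrightarrow> k < m \<Longrightarrow> (q ^ 2) ^ k \<noteq> 1"
  shows "eigenspace scale X \<theta> =
      exp_q scale q (\<lambda>v. (t / (q - inverse q)) *s L v) ` eigenspace scale M \<theta>" (is ?thesis1)
    and "eigenspace scale M \<theta> =
      exp_q_inv scale q (\<lambda>v. (- (t / (q - inverse q))) *s L v) ` eigenspace scale X \<theta>" (is ?thesis2)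
proof -
  define c where "c = t / (q - inverse q)"
  let ?e = "\<lambda>n. q powi int (n choose 2) / q_fact q n * c ^ n"
  let ?e' = "\<lambda>n. q powi (- int (n choose 2)) / q_fact q n * (- c) ^ n"
  have fact: "q_fact q (Suc n) = q_int q (Suc n) * q_fact q n" for n
    by (simp add: q_fact_def)
  have e0: "?e 0 \<noteq> 0" "?e' 0 \<noteq> 0"
    by (simp_all add: q_fact_def numeral_2_eq_2)
  have ratio: "c / q_int q (Suc n) * ((q ^ 2) ^ Suc n - 1) = t * q ^ Suc n" if "Suc n < m" for n
    unfolding c_def using q(2)[of 1] q(2)[of "Suc n"] that q(1) by (intro q_int_Suc_ratio) auto
  have "?e (Suc n) * ((q ^ 2) ^ Suc n - 1) = t * q * ?e n * (q ^ 2) ^ n" if n: "Suc n < m" for n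
  proof -
    have "?e (Suc n) = q ^ n * ?e n * (c / q_int q (Suc n))"
      using q(1) by (simp add: fact choose_two_Suc power_int_add mult_ac)
    then have "?e (Suc n) * ((q ^ 2) ^ Suc n - 1) = q ^ n * ?e n * (t * q ^ Suc n)"
      unfolding ratio[OF n, symmetric] by (simp only: mult.assoc)
    also have "\<dots> = t * q * ?e n * (q ^ 2) ^ n"
      by (simp add: power2_eq_square power_mult_distrib)
    finally show ?thesis .
  qed
  then have 1: "X (power_series ?e L v) = power_series ?e L (M v)" for v
    by (rule X_power_series[OF L M rel X])
  have "?e' (Suc n) * ((q ^ 2) ^ Suc n - 1) = - (t * q * ?e' n)" if n: "Suc n < m" for n
  proof -
    have "?e' (Suc n) = - (inverse (q ^ n) * ?e' n) * (c / q_int q (Suc n))"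
      using q(1) by (simp add: fact choose_two_Suc power_int_add power_int_diff power_int_minus
          field_simps)
    then have "?e' (Suc n) * ((q ^ 2) ^ Suc n - 1) = - (inverse (q ^ n) * ?e' n) * (t * q ^ Suc n)"
      unfolding ratio[OF n, symmetric] by (simp only: mult.assoc)
    also have "\<dots> = - (t * q * ?e' n)"
      using q(1) by simp
    finally show ?thesis .
  qed
  then have 2: "M (power_series ?e' L v) = power_series ?e' L (X v)" for v
    by (rule M_power_series[OF L M rel X])
  have exp: "exp_q scale q (\<lambda>v. c *s L v) = power_series ?e L"
    "exp_q_inv scale q (\<lambda>v. (- c) *s L v) = power_series ?e' L"
    unfolding exp_q_def exp_q_inv_def by (rule ext, rule Sum_any_power_series[OF L])+
  have ser: "endo (power_series e L)" for e
    by (rule triangular_endo[OF triangular_power_series[OF L]])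
  show ?thesis1
    unfolding c_def[symmetric] exp 
    by (rule eigenspace_intertwine[of "power_series ?e L" X M])
      (rule ser bij_power_series[of L ?e, OF L e0(1)] 1)+
  show ?thesis2
    unfolding c_def[symmetric] exp 
    by (rule eigenspace_intertwine[of "power_series ?e' L" M X])
      (rule ser bij_power_series[of L ?e', OF L e0(2)] 2)+
qed

end

section \<open>Split decompositions\<close>

text \<open>The data of a TD pair from which a split decomposition is built. Reversing the order of
  the spaces \<open>V i\<close> yields the second split decomposition; since \<open>V'\<close> stays
  fixed, both instances share the flag \<open>F\<close>.\<close>

locale tridiagonal = finite_dimensional_vector_space scale Basis + operators scale
  for scale :: "'a::field \<Rightarrow> 'b::ab_group_add \<Rightarrow> 'b" (infixr "*s" 75) and Basis +
  fixes d :: nat and A A' :: "'b \<Rightarrow> 'b" and V V' :: "nat \<Rightarrow> 'b set" and \<theta> \<theta>' :: "nat \<Rightarrow> 'a"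
  assumes endo_A: "endo A" and endo_A': "endo A'"
    and A_V: "i \<le> d \<Longrightarrow> v \<in> V i \<Longrightarrow> A v = \<theta> i *s v"
    and A'_V': "i \<le> d \<Longrightarrow> v \<in> V' i \<Longrightarrow> A' v = \<theta>' i *s v"
    and sum_V: "subspace_sum scale V {0..d} = UNIV"
    and sum_V': "subspace_sum scale V' {0..d} = UNIV"
    and A'_V: "i \<le> d \<Longrightarrow> v \<in> V i \<Longrightarrow> A' v \<in> subspace_sum scale V {j. j \<le> d \<and> i \<le> j + 1 \<and> j \<le> i + 1}"
    and A_V': "i \<le> d \<Longrightarrow> v \<in> V' i \<Longrightarrow> A v \<in> subspace_sum scale V' {j. j \<le> d \<and> i \<le> j + 1 \<and> j \<le> i + 1}"
    and V_d: "\<exists>v\<in>V d. v \<noteq> 0" and V'_d: "\<exists>v\<in>V' d. v \<noteq> 0"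
    and \<theta>'_distinct: "i < d \<Longrightarrow> \<theta>' i \<noteq> \<theta>' d"
    and irreducible: "subspace W \<Longrightarrow> (\<And>w. w \<in> W \<Longrightarrow> A w \<in> W) \<Longrightarrow> (\<And>w. w \<in> W \<Longrightarrow> A' w \<in> W)
      \<Longrightarrow> W = {0} \<or> W = UNIV"
begin

text \<open>The sum of the first \<open>n\<close> spaces, so that the flag starts with
  \<open>F 0 = {0}\<close>. The sum with last index \<open>i\<close> is therefore
  \<open>F (Suc i)\<close>, as in \<open>U\<close> below.\<close>

definition F :: "nat \<Rightarrow> 'b set" where
  "F n = subspace_sum scale V' {..<n}"

definition G :: "nat \<Rightarrow> 'b set" where
  "G n = subspace_sum scale V {n..d}"

definition U :: "nat \<Rightarrow> 'b set" where
  "U i = F (Suc i) \<inter> G i"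

lemma subspace_sum_mem: "i \<in> I \<Longrightarrow> v \<in> X i \<Longrightarrow> v \<in> subspace_sum scale X I"
  unfolding subspace_sum_def by (intro span_base) auto

lemma subspace_subspace_sum: "subspace (subspace_sum scale X I)"
  by (simp add: subspace_sum_def)

lemma subspace_sum_mono: "I \<subseteq> J \<Longrightarrow> subspace_sum scale X I \<subseteq> subspace_sum scale X J"
  unfolding subspace_sum_def by (intro span_mono) auto

lemma endo_subspace_sum_into:
  assumes "endo f" "subspace H" "\<And>i x. i \<in> I \<Longrightarrow> x \<in> X i \<Longrightarrow> f x \<in> H" "v \<in> subspace_sum scale X I"
  shows "f v \<in> H"
  using assms endo_span_into[of f H "\<Union>i\<in>I. X i" v] by (auto simp: subspace_sum_def)

sublocale flag scale Basis F "Suc d"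
proof
  show "subspace (F n)" for n
    unfolding F_def by (rule subspace_subspace_sum)
  show "F n \<subseteq> F (Suc n)" for n
    unfolding F_def by (rule subspace_sum_mono) auto
  show "F 0 = {0}" by (simp add: F_def subspace_sum_def)
  show "F (Suc d) = UNIV"
    using sum_V' by (simp add: F_def lessThan_Suc_atMost atMost_atLeast0)
qed

lemma subspace_G: "subspace (G n)"
  by (auto simp: G_def subspace_sum_def)

lemma G_Suc: "G (Suc n) \<subseteq> G n"
  unfolding G_def by (rule subspace_sum_mono) auto

lemma G_0: "G 0 = UNIV"
  using sum_V by (simp add: G_def)

lemma G_top: "G (Suc d) = {0}"
  by (simp add: G_def subspace_sum_def)

lemma subspace_U: "subspace (U i)"
  unfolding U_def by (intro subspace_inter subspace_F subspace_G)

section \<open>Action of \<open>A\<close> and \<open>A'\<close> on the filtrations \<open>F\<close>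
  and \<open>G\<close>\<close>

lemma A'_F:
  assumes n: "n \<le> d" and v: "v \<in> F (Suc n)"
  shows "A' v - \<theta>' n *s v \<in> F n"
  unfolding F_def
proof (rule endo_subspace_sum_into[OF endo_shift[OF endo_A'] subspace_subspace_sum _ v[unfolded F_def]])
  fix i x assume "i \<in> {..<Suc n}" "x \<in> V' i"
  note * = n this
  show "A' x - \<theta>' n *s x \<in> subspace_sum scale V' {..<n}"
  proof (cases "i = n")
    case True
    then show ?thesis using * A'_V'[of n x] by (simp add: subspace_0 subspace_subspace_sum)
  next
    case False
    then have "x \<in> subspace_sum scale V' {..<n}"
      using * by (intro subspace_sum_mem[of i]) auto
    then show ?thesis
      using * A'_V'[of i x] by (auto intro!: subspace_diff subspace_scale subspace_subspace_sum)
  qed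
qed

lemma A_F:
  assumes n: "n \<le> d" and v: "v \<in> F n"
  shows "A v \<in> F (Suc n)"
  unfolding F_def
proof (rule endo_subspace_sum_into[OF endo_A subspace_subspace_sum _ v[unfolded F_def]])
  fix i x assume "i \<in> {..<n}" "x \<in> V' i"
  note * = n this
  show "A x \<in> subspace_sum scale V' {..<Suc n}"
    by (rule subsetD[OF subspace_sum_mono A_V'[of i x]]) (use * in auto)
qed

lemma A_G:
  assumes n: "n \<le> d" and v: "v \<in> G n"
  shows "A v - \<theta> n *s v \<in> G (Suc n)"
  unfolding G_def
proof (rule endo_subspace_sum_into[OF endo_shift[OF endo_A] subspace_subspace_sum _ v[unfolded G_def]])
  fix i x assume "i \<in> {n..d}" "x \<in> V i"
  note * = n this
  show "A x - \<theta> n *s x \<in> subspace_sum scale V {Suc n..d}"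
  proof (cases "i = n")
    case True
    then show ?thesis using * A_V[of n x] by (simp add: subspace_0 subspace_subspace_sum)
  next
    case False
    then have "x \<in> subspace_sum scale V {Suc n..d}"
      using * by (intro subspace_sum_mem[of i]) auto
    then show ?thesis
      using * A_V[of i x] by (auto intro!: subspace_diff subspace_scale subspace_subspace_sum)
  qed
qed

lemma A'_G:
  assumes v: "v \<in> G (Suc n)"
  shows "A' v \<in> G n"
  unfolding G_def
proof (rule endo_subspace_sum_into[OF endo_A' subspace_subspace_sum _ v[unfolded G_def]])
  fix i x assume *: "i \<in> {Suc n..d}" "x \<in> V i"
  show "A' x \<in> subspace_sum scale V {n..d}"
    by (rule subsetD[OF subspace_sum_mono A'_V[of i x]]) (use * in auto)
qed

text \<open>Otherwise a nonzero eigenvector of \<open>A'\<close> for \<open>\<theta>' d\<close> lies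
  in \<open>F d\<close>. As \<open>\<theta>' d\<close> differs from the scalars
  \<open>\<theta>' n\<close> of \<open>A'\<close> on the quotients below, the vector descends to
  \<open>F 0\<close>.\<close>

lemma F_d: "F d \<noteq> UNIV"
proof
  assume *: "F d = UNIV"
  obtain v where v: "v \<in> V' d" "v \<noteq> 0" using V'_d by blast
  have "n \<le> d \<Longrightarrow> v \<in> F n \<Longrightarrow> v \<in> F 0" for n
  proof (induction n)
    case (Suc n)
    have "A' v - \<theta>' n *s v \<in> F n" using Suc.prems by (intro A'_F) auto
    then have "(\<theta>' d - \<theta>' n) *s v \<in> F n"
      using A'_V'[OF _ v(1)] by (simp add: scale_left_diff_distrib)
    then have "inverse (\<theta>' d - \<theta>' n) *s (\<theta>' d - \<theta>' n) *s v \<in> F n"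
      by (rule subspace_scale[OF subspace_F])
    then show ?case using \<theta>'_distinct[of n] Suc by simp
  qed simp
  then show False using v * F_0 by auto
qed

lemma shifted_image_in_span:
  assumes "\<And>n. n \<le> d \<Longrightarrow> subspace (P n)"
    and T: "endo T" "\<And>n v. n \<le> d \<Longrightarrow> v \<in> P n \<Longrightarrow> T v - t n *s v \<in> span (\<Union>i\<le>d. P i)"
    and w: "w \<in> span (\<Union>i\<le>d. P i)"
  shows "T w \<in> span (\<Union>i\<le>d. P i)"
proof (rule endo_span_into[OF T(1) subspace_span _ w])
  fix v assume "v \<in> (\<Union>i\<le>d. P i)"
  then obtain n where n: "n \<le> d" "v \<in> P n" by auto
  then have "(T v - t n *s v) + t n *s v \<in> span (\<Union>i\<le>d. P i)"
    by (intro span_add span_scale T(2) span_base[of v]) auto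
  then show "T v \<in> span (\<Union>i\<le>d. P i)" by simp
qed

text \<open>Up to scalar shifts, \<open>A\<close> sends \<open>F i \<inter> G i\<close> to the next
  such intersection and \<open>A'\<close> to the previous one. Their span is thus invariant, and it
  lies in the proper subspace \<open>F d\<close>, so irreducibility makes it zero.\<close>

lemma F_Int_G:
  assumes "n \<le> Suc d" "v \<in> F n" "v \<in> G n"
  shows "v = 0"
proof (cases "n = Suc d")
  case True
  then show ?thesis using assms G_top by auto
next
  case False
  let ?P = "\<lambda>i. F i \<inter> G i"
  let ?Z = "span (\<Union>i\<le>d. ?P i)"
  have sub: "subspace (?P i)" for i by (intro subspace_inter subspace_F subspace_G)
  have up: "A x - \<theta> i *s x \<in> ?Z" if i: "i \<le> d" and x: "x \<in> ?P i" for i x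
  proof -
    have "x \<in> F (Suc i)" using x F_Suc by auto
    then have "A x - \<theta> i *s x \<in> ?P (Suc i)"
      using A_F[of i x] A_G[of i x] i x by (auto intro: subspace_diff subspace_scale subspace_F)
    then show ?thesis
      using i G_top by (cases "Suc i \<le> d") (auto intro!: span_base span_zero simp: not_le less_Suc_eq_le
          le_antisym)
  qed
  \<comment> \<open>The last summand of \<open>F i\<close> has index \<open>i - 1\<close>, so
    \<open>A'\<close> acts on its top quotient as \<open>\<theta>' (i - 1)\<close>. At
    \<open>i = 0\<close> the intersection is zero.\<close>
  define t where "t i = \<theta>' (i - 1)" for i
  have down: "A' x - t i *s x \<in> ?Z" if i: "i \<le> d" and x: "x \<in> ?P i" for i x
  proof (cases i)
    case 0
    then show ?thesis using x F_0 by (simp add: endo_zero[OF endo_A'] span_zero)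
  next
    case (Suc k)
    have "x \<in> G k" using x Suc G_Suc by auto
    then have "A' x - t i *s x \<in> ?P k"
      using A'_F[of k x] A'_G[of x k] i x Suc
      by (auto simp: t_def intro: subspace_diff subspace_scale subspace_G)
    then show ?thesis using i Suc by (intro span_base) auto
  qed
  have "?Z = {0} \<or> ?Z = UNIV"
    using shifted_image_in_span[of ?P, OF sub endo_A up] shifted_image_in_span[of ?P, OF sub endo_A' down]
    by (intro irreducible) auto
  moreover have "?Z \<subseteq> F d"
    using F_mono[of _ d] by (intro span_minimal subspace_F) auto
  ultimately have "?Z = {0}" using F_d by auto
  moreover have "v \<in> ?Z" using assms False by (intro span_base) auto
  ultimately show ?thesis by auto
qed

section \<open>The split decomposition\<close>

lemma A_U:
  assumes "i \<le> d" "v \<in> U i"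
  shows "A v - \<theta> i *s v \<in> U (Suc i)"
proof -
  have "v \<in> F (Suc (Suc i))" using assms F_Suc by (auto simp: U_def)
  moreover have "A v \<in> F (Suc (Suc i))"
    using assms F_eq_UNIV[of "Suc (Suc i)"] by (cases "Suc i \<le> d") (auto simp: U_def intro!: A_F)
  ultimately show ?thesis
    using A_G[of i v] assms unfolding U_def
    by (auto intro!: subspace_diff subspace_scale subspace_F)
qed

text \<open>The target is \<open>U (i - 1)\<close> for \<open>i > 0\<close>. For
  \<open>i = 0\<close> the truncated index gives \<open>G 0\<close>, but \<open>F 0 = {0}\<close>
  forces the image to vanish.\<close>

lemma A'_U:
  assumes "i \<le> d" "v \<in> U i"
  shows "A' v - \<theta>' i *s v \<in> F i \<inter> G (i - 1)"
proof -
  have "A' v \<in> G (i - 1)" "v \<in> G (i - 1)"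
    using assms A'_G[of v "i - 1"] G_Suc[of "i - 1"] G_0 by (cases i; auto simp: U_def)+
  then show ?thesis
    using A'_F[of i v] assms unfolding U_def
    by (auto intro!: subspace_diff subspace_scale subspace_G)
qed

lemma A'_U_Suc: "Suc i \<le> d \<Longrightarrow> v \<in> U (Suc i) \<Longrightarrow> A' v - \<theta>' (Suc i) *s v \<in> U i"
  using A'_U[of "Suc i" v] by (simp add: U_def)

lemma A'_U_0: "v \<in> U 0 \<Longrightarrow> A' v - \<theta>' 0 *s v = 0"
  using A'_U[of 0 v] F_0 by simp

lemma A_U_d: "v \<in> U d \<Longrightarrow> A v - \<theta> d *s v = 0"
  using A_U[of d v] G_top by (simp add: U_def)

text \<open>The span is invariant because \<open>A\<close> raises and \<open>A'\<close> lowers the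
  index up to scalar shifts. It is nonzero since \<open>U d\<close> contains
  \<open>V d\<close>.\<close>

lemma span_U: "span (\<Union>i\<le>d. U i) = UNIV"
proof -
  let ?Z = "span (\<Union>i\<le>d. U i)"
  have up: "A x - \<theta> i *s x \<in> ?Z" if "i \<le> d" "x \<in> U i" for i x
  proof (cases "i = d")
    case True
    then show ?thesis using that A_U_d by (simp add: span_zero)
  next
    case False
    then show ?thesis using that A_U[of i x] by (intro span_base) auto
  qed
  have down: "A' x - \<theta>' i *s x \<in> ?Z" if "i \<le> d" "x \<in> U i" for i x
  proof (cases i)
    case 0
    then show ?thesis using that A'_U_0 by (simp add: span_zero)
  next
    case (Suc k)
    then show ?thesis using that A'_U_Suc[of k x] by (intro span_base) auto
  qed
  obtain v where v: "v \<in> V d" "v \<noteq> 0" using V_d by blast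
  have "v \<in> U d"
    using v(1) F_top by (auto simp: U_def G_def intro!: subspace_sum_mem[of d])
  then have "v \<in> ?Z" by (intro span_base) auto
  moreover have "?Z = {0} \<or> ?Z = UNIV"
    using shifted_image_in_span[of U, OF subspace_U endo_A up]
      shifted_image_in_span[of U, OF subspace_U endo_A' down]
    by (intro irreducible) auto
  ultimately show ?thesis using v(2) by auto
qed

lemma sum_U_split:
  assumes "n \<le> Suc d"
  shows "(\<Sum>i\<le>d. u i :: 'b) = (\<Sum>i<n. u i) + (\<Sum>i\<in>{n..d}. u i)"
proof -
  have "{..d} = {..<n} \<union> {n..d}" using assms by auto
  then show ?thesis by (simp add: sum.union_disjoint ivl_disj_int)
qed

lemma sum_U_below: "(\<And>i. i < n \<Longrightarrow> u i \<in> U i) \<Longrightarrow> (\<Sum>i<n. u i) \<in> F n"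
  using F_mono by (intro subspace_sum subspace_F) (fastforce simp: U_def Suc_le_eq[symmetric] simp del: Suc_le_eq)

lemma G_antimono: "n \<le> k \<Longrightarrow> G k \<subseteq> G n"
  by (rule lift_Suc_antimono_le[of G]) (rule G_Suc)

lemma sum_U_above: "(\<And>i. i \<in> {n..d} \<Longrightarrow> u i \<in> U i) \<Longrightarrow> (\<Sum>i\<in>{n..d}. u i) \<in> G n"
  using G_antimono by (intro subspace_sum subspace_G) (fastforce simp: U_def)

text \<open>If the components add up to zero, the partial sum over \<open>i < n\<close> lies in
  \<open>F n\<close> and equals minus the remaining sum, which lies in \<open>G n\<close>. So every
  partial sum vanishes, and with them all components.\<close>

lemma direct_decomposition_U: "direct_decomposition d U"
  unfolding direct_decomposition_def
proof (intro conjI allI impI)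
  show "subspace (U i)" for i by (rule subspace_U)
  show "span (\<Union>i\<le>d. U i) = UNIV" by (rule span_U)
  fix u i assume u: "\<forall>i\<le>d. u i \<in> U i" and sum: "(\<Sum>i\<le>d. u i) = 0" and i: "i \<le> d"
  have zero: "(\<Sum>i<n. u i) = 0" if n: "n \<le> Suc d" for n
  proof (rule F_Int_G[OF n])
    show "(\<Sum>i<n. u i) \<in> F n" using u n by (intro sum_U_below) auto
    have "(\<Sum>i<n. u i) = - (\<Sum>i\<in>{n..d}. u i)"
      using sum_U_split[OF n, of u] sum by (simp add: eq_neg_iff_add_eq_0)
    also have "\<dots> \<in> G n" using u by (intro subspace_neg subspace_G sum_U_above) auto
    finally show "(\<Sum>i<n. u i) \<in> G n" .
  qed
  show "u i = 0" using zero[of i] zero[of "Suc i"] i by simp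
qed

text \<open>In effect \<open>F (Suc n)\<close> is the sum of \<open>U 0\<close> to
  \<open>U n\<close>. Consequently the weight maps of the two split decompositions are triangular
  for the same flag with the same diagonal.\<close>

lemma triangular_weight_map:
  "triangular (weight_map scale d q U) (\<lambda>i. q powi (int d - 2 * int i))"
proof (rule triangularI)
  let ?X = "weight_map scale d q U"
  let ?c = "\<lambda>i. q powi (int d - 2 * int i)"
  show X: "endo ?X" by (rule endo_weight_map[OF direct_decomposition_U])
  fix n v assume n: "n < Suc d" and v: "v \<in> F (Suc n)"
  obtain u where u: "\<And>i. i \<le> d \<Longrightarrow> u i \<in> U i" and v_eq: "v = (\<Sum>i\<le>d. u i)"
    using span_UN_atMost_decompose[of d U v] subspace_U span_U by auto
  have split: "v = (\<Sum>i<Suc n. u i) + (\<Sum>i\<in>{Suc n..d}. u i)"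
    using n unfolding v_eq by (intro sum_U_split) auto
  have below: "(\<Sum>i<Suc n. u i) \<in> F (Suc n)" using u n by (intro sum_U_below) auto
  have "(\<Sum>i\<in>{Suc n..d}. u i) = 0"
  proof (rule F_Int_G)
    show "Suc n \<le> Suc d" using n by simp
    show "(\<Sum>i\<in>{Suc n..d}. u i) \<in> G (Suc n)" using u by (intro sum_U_above) auto
    have "v - (\<Sum>i<Suc n. u i) \<in> F (Suc n)"
      by (rule subspace_diff[OF subspace_F v below])
    then show "(\<Sum>i\<in>{Suc n..d}. u i) \<in> F (Suc n)" using split by simp
  qed
  then have v': "v = (\<Sum>i<Suc n. u i)" using split by simp
  have "?X v = (\<Sum>i<Suc n. ?c i *s u i)"
    unfolding v' endo_sum[OF X] using u n
    by (intro sum.cong) (auto simp: weight_map_apply[OF direct_decomposition_U])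
  then have "?X v - ?c n *s v = (\<Sum>i<n. (?c i - ?c n) *s u i)"
    by (simp add: v' scale_left_diff_distrib scale_right_distrib sum_subtractf scale_sum_right)
  also have "\<dots> \<in> F n"
    using u n by (intro sum_U_below subspace_scale subspace_U) auto
  finally show "?X v - ?c n *s v \<in> F n" .
qed

text \<open>Write \<open>X\<close> for the weight map. On \<open>U i\<close>, of weight
  \<open>c\<close>, the part \<open>T - \<tau> i\<close> moves into a summand of weight
  \<open>c / p\<close>, so \<open>T X - p X T\<close> acts as \<open>(1 - p) * c * \<tau> i\<close>.
  The assumption on \<open>\<tau>\<close> turns this into a polynomial in \<open>X\<close> that no
  longer depends on \<open>i\<close>.\<close>

lemma weight_map_relation:
  assumes T: "endo T"
    and shift: "\<And>i v. i \<le> d \<Longrightarrow> v \<in> U i \<Longrightarrow>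
      p *s weight_map scale d q U (T v - \<tau> i *s v) = q powi (int d - 2 * int i) *s (T v - \<tau> i *s v)"
    and \<tau>: "\<And>i. i \<le> d \<Longrightarrow> q powi (int d - 2 * int i) * \<tau> i = t * (q powi (int d - 2 * int i)) ^ 2 + t'"
  shows "T (weight_map scale d q U v) =
    p *s weight_map scale d q U (T v)
      + (1 - p) *s (t *s weight_map scale d q U (weight_map scale d q U v) + t' *s v)"
proof -
  let ?X = "weight_map scale d q U"
  have X: "endo ?X" by (rule endo_weight_map[OF direct_decomposition_U])
  have "(\<lambda>v. T (?X v)) = (\<lambda>v. p *s ?X (T v) + (1 - p) *s (t *s ?X (?X v) + t' *s v))"
  proof (rule endo_eq_on_span[OF _ _ span_U])
    show "endo (\<lambda>v. T (?X v))"
      by (rule endoI) (simp_all add: endo_simps[OF T] endo_simps[OF X])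
    show "endo (\<lambda>v. p *s ?X (T v) + (1 - p) *s (t *s ?X (?X v) + t' *s v))"
      by (rule endoI) (simp_all add: endo_simps[OF T] endo_simps[OF X] algebra_simps)
    fix v assume "v \<in> (\<Union>i\<le>d. U i)"
    then obtain i where i: "i \<le> d" and v: "v \<in> U i" by auto
    define c where "c = q powi (int d - 2 * int i)"
    define w where "w = T v - \<tau> i *s v"
    have Tv: "T v = \<tau> i *s v + w" by (simp add: w_def)
    have Xv: "?X v = c *s v" using weight_map_apply[OF direct_decomposition_U i v] by (simp add: c_def)
    have Xw: "p *s ?X w = c *s w" using shift[OF i v] by (simp add: c_def w_def)
    have c: "c * \<tau> i = t * c ^ 2 + t'" using \<tau>[OF i] by (simp add: c_def)
    have "T (?X v) = (c * \<tau> i) *s v + c *s w"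
      by (simp add: Xv endo_simps[OF T] Tv scale_right_distrib)
    moreover have "p *s ?X (T v) = (p * (c * \<tau> i)) *s v + c *s w"
      by (simp add: Xv endo_simps[OF X] Tv scale_right_distrib Xw mult_ac)
    moreover have "t *s ?X (?X v) + t' *s v = (c * \<tau> i) *s v"
      by (simp add: c Xv endo_simps[OF X] scale_left_distrib power2_eq_square mult_ac)
    ultimately show "T (?X v) = p *s ?X (T v) + (1 - p) *s (t *s ?X (?X v) + t' *s v)"
      by (simp add: algebra_simps)
  qed
  then show ?thesis by (rule fun_cong)
qed

text \<open>\<open>A\<close> raises the index, which divides the weight by \<open>q ^ 2\<close>;
  hence \<open>p = q ^ 2\<close>. Multiplying \<open>\<theta> i\<close> by the weight gives the
  quadratic expression.\<close>

lemma A_weight_map: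
  assumes q: "q \<noteq> 0"
    and \<theta>: "\<And>i. i \<le> d \<Longrightarrow>
      \<theta> i = a * q powi (int d - 2 * int i) + inverse a * q powi (2 * int i - int d)"
  shows "A (weight_map scale d q U v) =
    q ^ 2 *s weight_map scale d q U (A v)
      + (1 - q ^ 2) *s (a *s weight_map scale d q U (weight_map scale d q U v) + inverse a *s v)"
proof (rule weight_map_relation[OF endo_A])
  fix i v assume i: "i \<le> d" "v \<in> U i"
  have X: "endo (weight_map scale d q U)" by (rule endo_weight_map[OF direct_decomposition_U])
  show "q ^ 2 *s weight_map scale d q U (A v - \<theta> i *s v)
      = q powi (int d - 2 * int i) *s (A v - \<theta> i *s v)"
  proof (cases "i = d")
    case True
    then show ?thesis using A_U_d i by (simp add: endo_zero[OF X])
  next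
    case False
    have "weight_map scale d q U (A v - \<theta> i *s v) = q powi (int d - 2 * int (Suc i)) *s (A v - \<theta> i *s v)"
      using False i by (intro weight_map_apply[OF direct_decomposition_U] A_U) auto
    moreover have "q ^ 2 * q powi (int d - 2 * int (Suc i)) = q powi (2 + (int d - 2 * int (Suc i)))"
      using q by (subst power_int_add) auto
    ultimately show ?thesis by simp
  qed
next
  fix i assume i: "i \<le> d"
  have "q powi (2 * int i - int d) = inverse (q powi (int d - 2 * int i))"
    by (simp flip: power_int_minus)
  then show "q powi (int d - 2 * int i) * \<theta> i = a * (q powi (int d - 2 * int i)) ^ 2 + inverse a"
    using q by (simp add: \<theta>[OF i] algebra_simps power2_eq_square)
qed

text \<open>\<open>A'\<close> lowers the index, so here \<open>p\<close> is the inverse of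
  \<open>q ^ 2\<close>.\<close>

lemma A'_weight_map:
  assumes q: "q \<noteq> 0"
    and \<theta>': "\<And>i. i \<le> d \<Longrightarrow>
      \<theta>' i = b * q powi (int d - 2 * int i) + inverse b * q powi (2 * int i - int d)"
  shows "A' (weight_map scale d q U v) =
    inverse (q ^ 2) *s weight_map scale d q U (A' v)
      + (1 - inverse (q ^ 2)) *s (b *s weight_map scale d q U (weight_map scale d q U v) + inverse b *s v)"
proof (rule weight_map_relation[OF endo_A'])
  fix i v assume i: "i \<le> d" "v \<in> U i"
  have X: "endo (weight_map scale d q U)" by (rule endo_weight_map[OF direct_decomposition_U])
  show "inverse (q ^ 2) *s weight_map scale d q U (A' v - \<theta>' i *s v)
      = q powi (int d - 2 * int i) *s (A' v - \<theta>' i *s v)"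
  proof (cases i)
    case 0
    then show ?thesis using A'_U_0 i by (simp add: endo_zero[OF X])
  next
    case (Suc k)
    have "weight_map scale d q U (A' v - \<theta>' i *s v) = q powi (int d - 2 * int k) *s (A' v - \<theta>' i *s v)"
      using Suc i by (intro weight_map_apply[OF direct_decomposition_U]) (auto intro: A'_U_Suc)
    moreover have "q powi (int d - 2 * int k) = q powi (2 + (int d - 2 * int i))"
      using Suc by simp
    moreover have "\<dots> = q ^ 2 * q powi (int d - 2 * int i)"
      using q by (subst power_int_add) auto
    ultimately show ?thesis using q by simp
  qed
next
  fix i assume i: "i \<le> d"
  have "q powi (2 * int i - int d) = inverse (q powi (int d - 2 * int i))"
    by (simp flip: power_int_minus)
  then show "q powi (int d - 2 * int i) * \<theta>' i = b * (q powi (int d - 2 * int i)) ^ 2 + inverse b"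
    using q by (simp add: \<theta>'[OF i] algebra_simps power2_eq_square)
qed

end

section \<open>The relation between the weight maps of two split decompositions\<close>

context tridiagonal
begin

definition q_commutator :: "'a \<Rightarrow> ('b \<Rightarrow> 'b) \<Rightarrow> ('b \<Rightarrow> 'b) \<Rightarrow> 'b \<Rightarrow> 'b" where
  "q_commutator p M N v = M (N v) - p *s N (M v)"

context
  fixes K B M N :: "'b \<Rightarrow> 'b" and p r a c b b' :: 'a
  assumes K: "endo K" and B: "endo B" and M: "endo M" and N: "endo N"
    and K_eq: "\<And>v. K v = M v - c *s N v" and B_eq: "\<And>v. B v = M v - a *s N v"
    and ac: "a * c = 1" and a_c: "a \<noteq> c"
    and A_K: "\<And>v. A (K v) = p *s K (A v) + (1 - p) *s (a *s K (K v) + c *s v)"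
    and A_B: "\<And>v. A (B v) = p *s B (A v) + (1 - p) *s (c *s B (B v) + a *s v)"
    and A'_K: "\<And>v. A' (K v) = r *s K (A' v) + (1 - r) *s (b *s K (K v) + b' *s v)"
    and A'_B: "\<And>v. A' (B v) = r *s B (A' v) + (1 - r) *s (b *s B (B v) + b' *s v)"
    and pr: "p * r = 1"
begin

lemma ac_simps: "a * c = 1" "a * (c * x) = x" "a * (x * c) = x" "a * (x * (c * y)) = x * y"
  using ac by (simp_all add: mult.left_commute[of a] mult.assoc[symmetric])

lemma pr_simps: "p * r = 1" "p * (r * x) = x"
  using pr by (simp_all add: mult.assoc[symmetric])

lemmas lin = endo_simps[OF M] endo_simps[OF N] endo_simps[OF endo_A] endo_simps[OF endo_A']

lemma M_scaled: "(a - c) *s M v = a *s K v - c *s B v"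
  by (simp add: K_eq B_eq algebra_simps)

lemma N_scaled: "(a - c) *s N v = K v - B v"
  by (simp add: K_eq B_eq algebra_simps)

lemma cancel_a_c: "(a - c) *s x = (a - c) *s y \<Longrightarrow> x = y"
  using a_c by (simp del: scale_left_diff_distrib)

text \<open>In the application \<open>M\<close> is \<open>\<M>\<close> and \<open>N = q \<psi> \<M>\<close>.\<close>

lemma A_M: "A (M v) = p *s M (A v) + (1 - p) *s ((a + c) *s M (M v) - M (N v) - N (M v))"
proof (rule cancel_a_c)
  have "(a - c) *s A (M v) = a *s A (K v) - c *s A (B v)"
    by (simp only: endo_scale[OF endo_A, symmetric] endo_diff[OF endo_A, symmetric] M_scaled)
  also have "\<dots> = (a - c) *s (p *s M (A v) + (1 - p) *s ((a + c) *s M (M v) - M (N v) - N (M v)))"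
    \<comment> \<open>\<open>A\<close> has to pass \<open>K\<close> and \<open>B\<close> before
      these are expanded, since \<open>K_eq\<close> and \<open>B_eq\<close> would destroy the left
      sides of \<open>A_K\<close> and \<open>A_B\<close>.\<close>
    by (simp add: A_K A_B) (simp add: K_eq B_eq lin algebra_simps ac_simps)
  finally show "(a - c) *s A (M v) = \<dots>" .
qed

lemma A_N: "A (N v) = p *s N (A v) + (1 - p) *s (M (M v) - N (N v) - v)"
proof (rule cancel_a_c)
  have "(a - c) *s A (N v) = A (K v) - A (B v)"
    by (simp only: endo_scale[OF endo_A, symmetric] endo_diff[OF endo_A, symmetric] N_scaled)
  also have "\<dots> = (a - c) *s (p *s N (A v) + (1 - p) *s (M (M v) - N (N v) - v))"
    by (simp add: A_K A_B) (simp add: K_eq B_eq lin algebra_simps ac_simps)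
  finally show "(a - c) *s A (N v) = \<dots>" .
qed

lemma A'_M: "A' (M v) = r *s M (A' v) + (1 - r) *s (b *s (M (M v) - N (N v)) + b' *s v)"
proof (rule cancel_a_c)
  have "(a - c) *s A' (M v) = a *s A' (K v) - c *s A' (B v)"
    by (simp only: endo_scale[OF endo_A', symmetric] endo_diff[OF endo_A', symmetric] M_scaled)
  also have "\<dots> = (a - c) *s (r *s M (A' v) + (1 - r) *s (b *s (M (M v) - N (N v)) + b' *s v))"
    by (simp add: A'_K A'_B) (simp add: K_eq B_eq lin algebra_simps ac_simps)
  finally show "(a - c) *s A' (M v) = \<dots>" .
qed

lemma A'_N: "A' (N v) = r *s N (A' v) + (1 - r) *s b *s (M (N v) + N (M v) - (a + c) *s N (N v))"
proof (rule cancel_a_c)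
  have "(a - c) *s A' (N v) = A' (K v) - A' (B v)"
    by (simp only: endo_scale[OF endo_A', symmetric] endo_diff[OF endo_A', symmetric] N_scaled)
  also have "\<dots> = (a - c) *s (r *s N (A' v) + (1 - r) *s b *s (M (N v) + N (M v) - (a + c) *s N (N v)))"
    by (simp add: A'_K A'_B) (simp add: K_eq B_eq lin algebra_simps ac_simps)
  finally show "(a - c) *s A' (N v) = \<dots>" .
qed

abbreviation Y where "Y \<equiv> q_commutator p M N"

text \<open>Each passage of \<open>A\<close> past \<open>M\<close> or \<open>N\<close> costs a
  factor \<open>p\<close>. Among the corrections the terms in \<open>M v\<close> and
  \<open>M (M (M v))\<close> cancel, and the rest regroups into words containing
  \<open>Y\<close>.\<close>

lemma A_Y: "A (Y v) = p ^ 2 *s Y (A v) +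
    (1 - p) *s ((a + c) *s (M (Y v) + p *s Y (M v)) - (p + 1) *s (Y (N v) + N (Y v)))"
  unfolding q_commutator_def by (simp add: lin A_M A_N algebra_simps power2_eq_square)

text \<open>Here it is \<open>p * r = 1\<close> that makes the terms in \<open>N v\<close> and
  \<open>N (N (N v))\<close> cancel.\<close>

lemma A'_Y: "A' (Y v) = r ^ 2 *s Y (A' v) +
    (1 - r) *s b *s ((1 + r) *s (M (Y v) + Y (M v)) - (a + c) *s (r *s Y (N v) + N (Y v)))"
  unfolding q_commutator_def by (simp add: lin A'_M A'_N algebra_simps power2_eq_square pr_simps)

lemma q_commutator_eq_0:
  assumes "\<And>v. Y v \<in> F d"
    and "\<And>v. v \<in> F d \<Longrightarrow> M v \<in> F d" "\<And>v. v \<in> F d \<Longrightarrow> N v \<in> F d"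
  shows "Y v = 0"
proof -
  define \<H> where "\<H> = {H. subspace H \<and> range Y \<subseteq> H \<and> M ` H \<subseteq> H \<and> N ` H \<subseteq> H}"
  define S where "S = \<Inter>\<H>"
  have S: "subspace S" unfolding S_def \<H>_def by (intro subspace_Inter) auto
  have SY: "Y v \<in> S" and SM: "v \<in> S \<Longrightarrow> M v \<in> S" and SN: "v \<in> S \<Longrightarrow> N v \<in> S" for v
    unfolding S_def \<H>_def by blast+
  note S_closed = subspace_add[OF S] subspace_diff[OF S] subspace_scale[OF S] SY SM SN
  have S_min: "S \<subseteq> H" if "H \<in> \<H>" for H using that by (auto simp: S_def)
  \<comment> \<open>Minimality replaces an induction over words in \<open>M\<close> and
    \<open>N\<close>: the vectors of \<open>S\<close> that \<open>T\<close> sends into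
    \<open>S\<close> form a member of \<open>\<H>\<close>, hence are all of
    \<open>S\<close>.\<close>
  have invariant: "T x \<in> S"
    if T: "endo T" "\<And>v. T (Y v) \<in> S" "\<And>v. v \<in> S \<Longrightarrow> T v \<in> S \<Longrightarrow> T (M v) \<in> S"
      "\<And>v. v \<in> S \<Longrightarrow> T v \<in> S \<Longrightarrow> T (N v) \<in> S" and x: "x \<in> S" for T x
  proof -
    have "S \<inter> {v. T v \<in> S} \<in> \<H>"
      using subspace_inter[OF S subspace_vimage[OF T(1) S]] T(2-4) SY SM SN by (auto simp: \<H>_def)
    then show ?thesis using S_min x by blast
  qed
  have "A x \<in> S" if "x \<in> S" for x
  proof (rule invariant[OF endo_A _ _ _ that])
    show "A (Y v) \<in> S" for v unfolding A_Y by (intro S_closed)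
    show "A (M v) \<in> S" "A (N v) \<in> S" if "v \<in> S" "A v \<in> S" for v
      unfolding A_M A_N by (intro S_closed that)+
  qed
  moreover have "A' x \<in> S" if "x \<in> S" for x
  proof (rule invariant[OF endo_A' _ _ _ that])
    show "A' (Y v) \<in> S" for v unfolding A'_Y by (intro S_closed)
    show "A' (M v) \<in> S" "A' (N v) \<in> S" if "v \<in> S" "A' v \<in> S" for v
      unfolding A'_M A'_N by (intro S_closed that)+
  qed
  ultimately have "S = {0} \<or> S = UNIV" by (intro irreducible S) auto
  moreover have "F d \<in> \<H>" using assms subspace_F by (auto simp: \<H>_def)
  ultimately have "S = {0}" using S_min F_d by blast
  then show ?thesis using SY[of v] by simp
qed

end

end

section \<open>Tridiagonal systems of q-Racah type\<close>

lemma weight_map_cong: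
  "(\<And>i. i \<le> d \<Longrightarrow> X i = X' i) \<Longrightarrow> weight_map s d q X = weight_map s d q X'"
  unfolding weight_map_def by (metis (no_types, lifting))

lemma subspace_sum_image: "subspace_sum s X (f ` I) = subspace_sum s (\<lambda>i. X (f i)) I"
  by (simp add: subspace_sum_def image_image)

lemma image_diff_atLeastAtMost_top:
  fixes i d :: nat
  assumes "i \<le> d"
  shows "(\<lambda>j. d - j) ` {i..d} = {0..d - i}"
proof (intro set_eqI iffI)
  fix k assume "k \<in> {0..d - i}"
  then show "k \<in> (\<lambda>j. d - j) ` {i..d}" using assms by (intro image_eqI[of _ _ "d - k"]) auto
qed auto

context operators
begin

lemma eigenvalue_on_eigenspace:
  assumes "w \<in> eigenspace scale A c" "w \<noteq> 0"
  shows "eigenvalue_on scale A (eigenspace scale A c) = c"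
  unfolding eigenvalue_on_def
proof (rule the_equality)
  show "\<forall>v\<in>eigenspace scale A c. A v = c *s v" by (simp add: eigenspace_def)
  fix x assume "\<forall>v\<in>eigenspace scale A c. A v = x *s v"
  then have "x *s w = c *s w" using assms by (auto simp: eigenspace_def)
  then show "x = c" using assms(2) by simp
qed

lemma eigenspace_ordering:
  assumes A: "endo A" "diagonalizable scale A" and X: "bij_betw X {0..d} (eigenspaces scale A)"
  shows "i \<le> d \<Longrightarrow> X i = eigenspace scale A (eigenvalue_on scale A (X i))"
    and "i \<le> d \<Longrightarrow> \<exists>v\<in>X i. v \<noteq> 0"
    and "subspace_sum scale X {0..d} = UNIV"
    and "i \<le> d \<Longrightarrow> j \<le> d \<Longrightarrow> i \<noteq> j \<Longrightarrow> eigenvalue_on scale A (X i) \<noteq> eigenvalue_on scale A (X j)"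
proof -
  have 1: "X i = eigenspace scale A (eigenvalue_on scale A (X i)) \<and> (\<exists>v\<in>X i. v \<noteq> 0)" if "i \<le> d" for i
  proof -
    have "X i \<in> eigenspaces scale A" using X that by (auto simp: bij_betw_def)
    then obtain c where c: "X i = eigenspace scale A c" "X i \<noteq> {0}" by (auto simp: eigenspaces_def)
    moreover have "0 \<in> X i" using c subspace_0[OF subspace_eigenspace[OF A(1)]] by simp
    ultimately obtain w where "w \<in> X i" "w \<noteq> 0" by blast
    then show ?thesis using c(1) eigenvalue_on_eigenspace[of w A c] by auto
  qed
  then show "i \<le> d \<Longrightarrow> X i = eigenspace scale A (eigenvalue_on scale A (X i))"
    and "i \<le> d \<Longrightarrow> \<exists>v\<in>X i. v \<noteq> 0" by blast+
  show "subspace_sum scale X {0..d} = UNIV"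
    using A(2) X by (simp add: subspace_sum_def diagonalizable_def bij_betw_def)
  show "eigenvalue_on scale A (X i) \<noteq> eigenvalue_on scale A (X j)" if "i \<le> d" "j \<le> d" "i \<noteq> j"
    using 1[of i] 1[of j] that X by (metis atLeastAtMost_iff bij_betw_def inj_on_eq_iff zero_le)
qed

end

lemma (in finite_dimensional_vector_space) tridiagonal_of_td_system:
  assumes "td_system scale d A E A' E'"
  shows "tridiagonal scale Basis d A A' (\<lambda>i. range (E i)) (\<lambda>i. range (E' i))
      (\<lambda>i. eigenvalue_on scale A (range (E i))) (\<lambda>i. eigenvalue_on scale A' (range (E' i)))"
    and "tridiagonal scale Basis d A A' (\<lambda>i. range (E (d - i))) (\<lambda>i. range (E' i))
      (\<lambda>i. eigenvalue_on scale A (range (E (d - i)))) (\<lambda>i. eigenvalue_on scale A' (range (E' i)))"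
    and "i \<le> d \<Longrightarrow> j \<le> d \<Longrightarrow> i \<noteq> j \<Longrightarrow>
      eigenvalue_on scale A (range (E i)) \<noteq> eigenvalue_on scale A (range (E j))"
proof -
  interpret operators scale ..
  have pair: "endo A" "endo A'" "diagonalizable scale A" "diagonalizable scale A'"
    "W = {0} \<or> W = UNIV" if "subspace W" "\<And>w. w \<in> W \<Longrightarrow> A w \<in> W" "\<And>w. w \<in> W \<Longrightarrow> A' w \<in> W" for W
    using assms that unfolding td_system_def td_pair_def by blast+
  \<comment> \<open>These four facts do not mention \<open>W\<close>; the choice \<open>UNIV\<close>
    discharges the invariance premises.\<close>
  note lin = pair(1-4)[of UNIV, simplified]
  have ord: "bij_betw (\<lambda>i. range (E i)) {0..d} (eigenspaces scale A)"
      "bij_betw (\<lambda>i. range (E' i)) {0..d} (eigenspaces scale A')"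
    and near: "\<And>i v. i \<le> d \<Longrightarrow> v \<in> range (E i) \<Longrightarrow>
        A' v \<in> subspace_sum scale (\<lambda>i. range (E i)) {j. j \<le> d \<and> i \<le> j + 1 \<and> j \<le> i + 1}"
      "\<And>i v. i \<le> d \<Longrightarrow> v \<in> range (E' i) \<Longrightarrow>
        A v \<in> subspace_sum scale (\<lambda>i. range (E' i)) {j. j \<le> d \<and> i \<le> j + 1 \<and> j \<le> i + 1}"
    using assms unfolding td_system_def standard_ordering_def by blast+
  note eig = eigenspace_ordering[OF lin(1,3) ord(1)]
  note eig' = eigenspace_ordering[OF lin(2,4) ord(2)]
  have A_E: "A v = eigenvalue_on scale A (range (E i)) *s v" if "i \<le> d" "v \<in> range (E i)" for i v
    using that eig(1)[of i] unfolding eigenspace_def by blast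
  have A'_E': "A' v = eigenvalue_on scale A' (range (E' i)) *s v" if "i \<le> d" "v \<in> range (E' i)" for i v
    using that eig'(1)[of i] unfolding eigenspace_def by blast
  show "tridiagonal scale Basis d A A' (\<lambda>i. range (E i)) (\<lambda>i. range (E' i))
      (\<lambda>i. eigenvalue_on scale A (range (E i))) (\<lambda>i. eigenvalue_on scale A' (range (E' i)))"
    by (intro tridiagonal.intro tridiagonal_axioms.intro finite_dimensional_vector_space_axioms operators_axioms)
      (rule lin A_E A'_E' eig(2,3) eig'(2-4) near pair(5); (assumption | simp))+
  \<comment> \<open>The reflection of the indices takes the neighbours of \<open>i\<close> to those
    of \<open>d - i\<close>, so the reversed ordering is standard as well.\<close>
  have rev: "subspace_sum scale (\<lambda>j. range (E (d - j))) {j. j \<le> d \<and> i \<le> j + 1 \<and> j \<le> i + 1}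
      = subspace_sum scale (\<lambda>i. range (E i)) {j. j \<le> d \<and> d - i \<le> j + 1 \<and> j \<le> d - i + 1}"
    (is "subspace_sum _ _ ?I = subspace_sum _ _ ?J") if "i \<le> d" for i
  proof -
    have "(\<lambda>j. d - j) ` ?I = ?J"
    proof (intro set_eqI iffI)
      fix k assume "k \<in> ?J"
      then show "k \<in> (\<lambda>j. d - j) ` ?I" using that by (intro image_eqI[of _ _ "d - k"]) auto
    qed (use that in auto)
    then show ?thesis
      using subspace_sum_image[of scale "\<lambda>i. range (E i)" "\<lambda>j. d - j" ?I] by simp
  qed
  have near_rev: "A' v \<in> subspace_sum scale (\<lambda>j. range (E (d - j))) {j. j \<le> d \<and> i \<le> j + 1 \<and> j \<le> i + 1}"
    if "i \<le> d" "v \<in> range (E (d - i))" for i v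
    unfolding rev[OF that(1)] using that by (intro near(1)) auto
  have rev_all: "subspace_sum scale (\<lambda>j. range (E (d - j))) {0..d} = UNIV"
    using eig(3) image_diff_atLeastAtMost_top[of 0 d]
      subspace_sum_image[of scale "\<lambda>i. range (E i)" "\<lambda>j. d - j" "{0..d}"] by simp
  show "tridiagonal scale Basis d A A' (\<lambda>i. range (E (d - i))) (\<lambda>i. range (E' i))
      (\<lambda>i. eigenvalue_on scale A (range (E (d - i)))) (\<lambda>i. eigenvalue_on scale A' (range (E' i)))"
    by (intro tridiagonal.intro tridiagonal_axioms.intro finite_dimensional_vector_space_axioms operators_axioms)
      (rule lin A_E A'_E' eig(2) eig'(2-4) near_rev near(2) rev_all pair(5); (assumption | simp))+
  show "i \<le> d \<Longrightarrow> j \<le> d \<Longrightarrow> i \<noteq> j \<Longrightarrow>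
      eigenvalue_on scale A (range (E i)) \<noteq> eigenvalue_on scale A (range (E j))"
    by (rule eig(4))
qed

text \<open>Each excluded case makes two eigenvalues coincide: \<open>(q ^ 2) ^ k = 1\<close> gives
  \<open>\<theta> k = \<theta> 0\<close>, and \<open>a = inverse a\<close> gives
  \<open>\<theta> d = \<theta> 0\<close>. Equal weights would make a power of \<open>q ^ 2\<close>
  equal to \<open>1\<close>.\<close>

lemma q_Racah_parameters:
  fixes q a :: "'a::field"
  assumes "q \<noteq> 0" "d \<ge> 1"
    and \<theta>: "\<And>i. i \<le> d \<Longrightarrow> \<theta> i = a * q powi (int d - 2 * int i) + inverse a * q powi (2 * int i - int d)"
    and inj: "\<And>i j. i \<le> d \<Longrightarrow> j \<le> d \<Longrightarrow> i \<noteq> j \<Longrightarrow> \<theta> i \<noteq> \<theta> j"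
  shows "0 < k \<Longrightarrow> k \<le> d \<Longrightarrow> (q ^ 2) ^ k \<noteq> 1"
    and "a \<noteq> inverse a"
    and "i \<le> d \<Longrightarrow> j \<le> d \<Longrightarrow> i \<noteq> j \<Longrightarrow> q powi (int d - 2 * int i) \<noteq> q powi (int d - 2 * int j)"
proof -
  show root: "(q ^ 2) ^ k \<noteq> 1" if k: "0 < k" "k \<le> d" for k
  proof
    assume *: "(q ^ 2) ^ k = 1"
    then have p: "q powi (2 * int k) = 1"
      by (metis of_nat_mult of_nat_numeral power_int_of_nat power_mult)
    have "q powi (int d - 2 * int k) = q powi int d" "q powi (2 * int k - int d) = q powi (- int d)"
      using assms(1) p by (simp_all add: power_int_diff power_int_minus field_simps)
    then have "\<theta> k = \<theta> 0" using \<theta>[of k] \<theta>[of 0] k by simp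
    then show False using inj[of k 0] k by simp
  qed
  show "a \<noteq> inverse a"
  proof
    assume "a = inverse a"
    then have "inverse a = a" by (rule sym)
    then have "\<theta> d = \<theta> 0" using \<theta>[of d] \<theta>[of 0] by (simp add: add.commute)
    then show False using inj[of d 0] assms(2) by simp
  qed
  have less: "q powi (int d - 2 * int i) \<noteq> q powi (int d - 2 * int j)" if "j < i" "i \<le> d" for i j
  proof
    assume *: "q powi (int d - 2 * int i) = q powi (int d - 2 * int j)"
    have "q powi (int d - 2 * int i) * q powi int (2 * (i - j))
        = q powi (int d - 2 * int i + int (2 * (i - j)))"
      by (rule power_int_add[symmetric]) (simp add: assms(1))
    also have "int d - 2 * int i + int (2 * (i - j)) = int d - 2 * int j"
      using that by (simp add: of_nat_diff)
    finally have "q powi int (2 * (i - j)) = 1"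
      using * assms(1) by (simp add: power_int_eq_0_iff)
    then have "(q ^ 2) ^ (i - j) = 1" unfolding power_int_of_nat by (simp add: power_mult)
    then show False using root[of "i - j"] that by simp
  qed
  show "i \<le> d \<Longrightarrow> j \<le> d \<Longrightarrow> i \<noteq> j \<Longrightarrow> q powi (int d - 2 * int i) \<noteq> q powi (int d - 2 * int j)"
    using less[of i j] less[of j i] by (cases "i < j") auto
qed

theorem proposition8p3:
  fixes s :: "'k::alg_closed_field \<Rightarrow> 'v::ab_group_add \<Rightarrow> 'v"
    and Basis :: "'v set"
    and A A' :: "'v \<Rightarrow> 'v"
    and E E' :: "nat \<Rightarrow> 'v \<Rightarrow> 'v"
    and d :: nat
    and q a b :: 'k
  assumes "finite_dimensional_vector_space s Basis"
    and "(UNIV :: 'v set) \<noteq> {0}"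
    and "td_system s d A E A' E'"
    and "d \<ge> 1"
    and "q_racah s d A E A' E' q a b"
  shows "let U = split_U s d E E';
             U_Down = split_U_Down s d E E';
             W = W_space s d E E' q a;
             \<psi> = psi_map s d E E' q a
         in \<forall>i\<le>d.
              U i = exp_q s q (\<lambda>v. s (inverse a / (q - inverse q)) (\<psi> v)) ` W i \<and>
              U_Down i = exp_q s q (\<lambda>v. s (a / (q - inverse q)) (\<psi> v)) ` W i \<and>
              W i = exp_q_inv s q (\<lambda>v. s (- (inverse a / (q - inverse q))) (\<psi> v)) ` U i \<and>
              W i = exp_q_inv s q (\<lambda>v. s (- (a / (q - inverse q))) (\<psi> v)) ` U_Down i"
proof -
  interpret finite_dimensional_vector_space s Basis by fact
  let ?V = "\<lambda>i. range (E i)" and ?V' = "\<lambda>i. range (E' i)"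
  let ?\<theta> = "\<lambda>i. eigenvalue_on s A (?V i)" and ?\<theta>' = "\<lambda>i. eigenvalue_on s A' (?V' i)"
  interpret up: tridiagonal s Basis d A A' ?V ?V' ?\<theta> ?\<theta>'
    by (rule tridiagonal_of_td_system) fact
  interpret down: tridiagonal s Basis d A A' "\<lambda>i. ?V (d - i)" ?V' "\<lambda>i. ?\<theta> (d - i)" ?\<theta>'
    by (rule tridiagonal_of_td_system) fact
  let ?\<kappa> = "\<lambda>i. q powi (int d - 2 * int i)"
  have q: "q \<noteq> 0" and a: "a \<noteq> 0"
    and \<theta>: "\<And>i. i \<le> d \<Longrightarrow> ?\<theta> i = a * ?\<kappa> i + inverse a * q powi (2 * int i - int d)"
    and \<theta>': "\<And>i. i \<le> d \<Longrightarrow> ?\<theta>' i = b * ?\<kappa> i + inverse b * q powi (2 * int i - int d)"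
    using assms(5) unfolding q_racah_def by auto
  \<comment> \<open>Reversal exchanges \<open>a\<close> and \<open>inverse a\<close>, so the
    relations for \<open>B\<close> are those for \<open>K\<close> with these two scalars
    swapped.\<close>
  have \<theta>_down: "?\<theta> (d - i) = inverse a * ?\<kappa> i + inverse (inverse a) * q powi (2 * int i - int d)"
    if "i \<le> d" for i
    using \<theta>[of "d - i"] that by (simp add: of_nat_diff algebra_simps)
  note par = q_Racah_parameters[OF q assms(4) \<theta> tridiagonal_of_td_system(3)[OF assms(3)]]

  have U: "split_U s d E E' i = up.U i" for i
    by (simp add: split_U_def up.U_def up.F_def up.G_def lessThan_Suc_atMost atMost_atLeast0)
  have U_Down: "split_U_Down s d E E' i = down.U i" if "i \<le> d" for i
    using subspace_sum_image[of s ?V "\<lambda>j. d - j" "{i..d}"]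
    by (simp add: split_U_Down_def down.U_def down.F_def down.G_def image_diff_atLeastAtMost_top[OF that]
        lessThan_Suc_atMost atMost_atLeast0)
  define K B where "K = K_map s d E E' q" and "B = B_map s d E E' q"
  have K_weight: "K = weight_map s d q up.U" and B_weight: "B = weight_map s d q down.U"
    unfolding K_def B_def K_map_def B_map_def by (rule weight_map_cong; simp add: U U_Down)+
  have K: "up.triangular K ?\<kappa>" and B: "up.triangular B ?\<kappa>"
    using up.triangular_weight_map down.triangular_weight_map by (simp_all add: K_weight B_weight)
  have \<kappa>: "?\<kappa> i \<noteq> 0" for i using q by (simp add: power_int_eq_0_iff)
  have K_endo: "up.endo K" and B_endo: "up.endo B"
    using K B by (simp_all add: up.triangular_endo)

  define \<delta> where "\<delta> = a - inverse a"
  have \<delta>: "\<delta> \<noteq> 0" using par(2) by (simp add: \<delta>_def)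
  define M where "M = M_map s d E E' q a"
  define N where "N v = s (inverse \<delta>) (K v - B v)" for v
  have M_eq: "M v = s (inverse \<delta> * a) (K v) + s (- (inverse \<delta> * inverse a)) (B v)" for v
    by (simp add: M_def M_map_def \<delta>_def K_def B_def scale_right_diff_distrib)
  \<comment> \<open>The coefficients of \<open>K\<close> and \<open>B\<close> add up to
    \<open>1\<close> in \<open>M\<close> and to \<open>0\<close> in \<open>N\<close>, so
    \<open>M\<close> inherits their common diagonal while \<open>N\<close> lowers the flag.\<close>
  have M: "up.triangular M ?\<kappa>"
  proof -
    have "up.triangular M (\<lambda>i. inverse \<delta> * a * ?\<kappa> i + - (inverse \<delta> * inverse a) * ?\<kappa> i)"
      unfolding M_eq[abs_def] by (rule up.triangular_combination[OF K B])
    moreover have "inverse \<delta> * a * x + - (inverse \<delta> * inverse a) * x = x" for x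
    proof -
      have "inverse \<delta> * a * x + - (inverse \<delta> * inverse a) * x = inverse \<delta> * \<delta> * x"
        by (simp add: \<delta>_def algebra_simps)
      then show ?thesis using \<delta> by simp
    qed
    ultimately show ?thesis by simp
  qed
  have N: "up.triangular N (\<lambda>_. 0)"
  proof -
    have N_eq: "N = (\<lambda>v. s (inverse \<delta>) (K v) + s (- inverse \<delta>) (B v))"
      by (simp add: N_def scale_right_diff_distrib fun_eq_iff)
    show ?thesis
      unfolding N_eq using up.triangular_combination[OF K B, of "inverse \<delta>" "- inverse \<delta>"] by simp
  qed
  have M_endo: "up.endo M" and N_endo: "up.endo N"
    using M N by (simp_all add: up.triangular_endo)
  have combine: "s (inverse \<delta> * x) v + s (- (inverse \<delta> * y)) v = v" if "x - y = \<delta>" for x y v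
  proof -
    have "s (inverse \<delta> * x) v + s (- (inverse \<delta> * y)) v = s (inverse \<delta> * (x - y)) v"
      by (simp add: algebra_simps)
    then show ?thesis using \<delta> that by simp
  qed
  have K_eq: "K v = M v - s (inverse a) (N v)" for v
    using combine[of a "inverse a" "K v"] by (simp add: M_eq N_def \<delta>_def algebra_simps)
  have B_eq: "B v = M v - s a (N v)" for v
    using combine[of a "inverse a" "B v"] by (simp add: M_eq N_def \<delta>_def algebra_simps)

  have MN: "M (N v) = s (q ^ 2) (N (M v))" for v
  proof -
    have "up.q_commutator (q ^ 2) M N v = 0"
    proof (rule up.q_commutator_eq_0[where K = K and B = B and a = a and c = "inverse a" and r = "inverse (q ^ 2)"
          and b = b and b' = "inverse b"])
      show "A (K v) = s (q ^ 2) (K (A v)) + s (1 - q ^ 2) (s a (K (K v)) + s (inverse a) v)" for v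
        unfolding K_weight by (rule up.A_weight_map[OF q \<theta>])
      show "A (B v) = s (q ^ 2) (B (A v)) + s (1 - q ^ 2) (s (inverse a) (B (B v)) + s a v)" for v
        using down.A_weight_map[OF q \<theta>_down] by (simp add: B_weight)
      show "A' (K v) = s (inverse (q ^ 2)) (K (A' v)) +
          s (1 - inverse (q ^ 2)) (s b (K (K v)) + s (inverse b) v)" for v
        unfolding K_weight by (rule up.A'_weight_map[OF q \<theta>'])
      show "A' (B v) = s (inverse (q ^ 2)) (B (A' v)) +
          s (1 - inverse (q ^ 2)) (s b (B (B v)) + s (inverse b) v)" for v
        unfolding B_weight by (rule down.A'_weight_map[OF q \<theta>'])
      have N_F: "N v \<in> up.F d" for v
        using up.triangularD[OF N, of d v] up.F_top by simp
      show N_inv: "N v \<in> up.F d" for v by (rule N_F)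
      show M_inv: "M v \<in> up.F d" if v: "v \<in> up.F d" for v
      proof -
        obtain n where n: "d = Suc n" using assms(4) by (cases d) auto
        have "M v - s (?\<kappa> n) v \<in> up.F n" using up.triangularD[OF M, of n v] v n by simp
        then have "(M v - s (?\<kappa> n) v) + s (?\<kappa> n) v \<in> up.F d"
          using v n up.F_Suc by (intro subspace_add subspace_scale up.subspace_F) auto
        then show ?thesis by simp
      qed
      show "up.q_commutator (q ^ 2) M N v \<in> up.F d" for v
        unfolding up.q_commutator_def by (intro subspace_diff subspace_scale up.subspace_F M_inv N_F)
    qed (use K_endo B_endo M_endo N_endo K_eq B_eq a q par(2) in auto)
    then show ?thesis by (simp add: up.q_commutator_def)
  qed

  have bij: "bij K" "bij M"
    using up.triangular_bij[OF K] up.triangular_bij[OF M] \<kappa> by auto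
  define \<psi> where "\<psi> = psi_map s d E E' q a"
  \<comment> \<open>Composing with \<open>K\<close> removes its inverse: the map inverted in
    \<open>\<psi>\<close> becomes \<open>q * \<delta>\<close> times \<open>M\<close>, and the left
    factor of \<open>\<psi>\<close> becomes \<open>\<delta>\<close> times \<open>N\<close>.\<close>
  have \<psi>M: "\<psi> (M v) = s (inverse q) (N v)" for v
  proof -
    let ?C = "B \<circ> inv K"
    let ?H = "\<lambda>v. s q (s a v - s (inverse a) (?C v))"
    have H: "?H (K w) = s (q * \<delta>) (M w)" for w
    proof -
      have "s (q * \<delta>) (M w) = s q (s (\<delta> * inverse \<delta>) (s a (K w) - s (inverse a) (B w)))"
        by (simp add: M_eq scale_right_diff_distrib mult_ac)
      then show ?thesis using bij \<delta> by (simp add: bij_is_inj)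
    qed
    have "inj ?H"
    proof (rule injI)
      fix x y assume eq: "?H x = ?H y"
      obtain x' y' where xy: "x = K x'" "y = K y'" using bij by (meson bij_pointE)
      have "s (q * \<delta>) (M x') = s (q * \<delta>) (M y')"
        using eq unfolding xy H .
      then have "M x' = M y'" using q \<delta> by simp
      then show "x = y" using bij xy by (simp add: bij_def inj_eq)
    qed
    moreover have "?H (K (s (inverse (q * \<delta>)) v)) = M v"
      unfolding H up.endo_scale[OF M_endo] using q \<delta>
      by (simp del: inverse_mult_distrib nonzero_inverse_mult_distrib)
    ultimately have "inv ?H (M v) = K (s (inverse (q * \<delta>)) v)"
      by (metis (no_types, lifting) inv_f_f)
    then have "\<psi> (M v) = K (s (inverse (q * \<delta>)) v) - B (s (inverse (q * \<delta>)) v)"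
      using bij by (simp add: \<psi>_def psi_map_def Let_def K_def[symmetric] B_def[symmetric] bij_is_inj)
    then show ?thesis
      by (simp add: N_def up.endo_scale[OF K_endo] up.endo_scale[OF B_endo] scale_right_diff_distrib
          mult.commute)
  qed
  have surj_M: "\<exists>w. v = M w" for v using bij by (meson bij_pointE)
  have \<psi>: "up.triangular \<psi> (\<lambda>_. 0)"
  proof (rule up.triangularI)
    show "up.endo \<psi>"
    proof (rule up.endoI)
      fix x y c
      obtain x' y' where xy: "x = M x'" "y = M y'" using surj_M by blast
      show "\<psi> (x + y) = \<psi> x + \<psi> y"
        unfolding xy up.endo_add[OF M_endo, symmetric] \<psi>M
        by (simp add: up.endo_add[OF N_endo] scale_right_distrib)
      show "\<psi> (s c x) = s c (\<psi> x)"
        unfolding xy up.endo_scale[OF M_endo, symmetric] \<psi>M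
        by (simp add: up.endo_scale[OF N_endo] mult.commute)
    qed
    fix n v assume n: "n < Suc d" and v: "v \<in> up.F (Suc n)"
    obtain w where w: "v = M w" using surj_M by blast
    \<comment> \<open>\<open>\<psi>\<close> is known only on images under \<open>M\<close>, so the
      preimage must be placed in the flag before \<open>N\<close> can lower it.\<close>
    have "w \<in> up.F (Suc n)" using up.triangular_reflect[OF M \<kappa>, of w "Suc n"] v w by simp
    then have "N w \<in> up.F n" using up.triangularD[OF N n, of w] by simp
    then show "\<psi> v - s 0 v \<in> up.F n" by (simp add: w \<psi>M subspace_scale up.subspace_F)
  qed
  have M\<psi>: "M (\<psi> v) = s (q ^ 2) (\<psi> (M v))" for v
  proof -
    obtain w where w: "v = M w" using surj_M by blast
    show ?thesis by (simp add: w \<psi>M up.endo_scale[OF M_endo] MN mult.commute)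
  qed
  have K_\<psi>: "K v = M v - s (inverse a * q) (\<psi> (M v))" for v using q by (simp add: K_eq \<psi>M)
  have B_\<psi>: "B v = M v - s (a * q) (\<psi> (M v))" for v using q by (simp add: B_eq \<psi>M)
  have roots: "(q ^ 2) ^ k \<noteq> 1" if "0 < k" "k < Suc d" for k using par(1) that by simp

  show ?thesis
    unfolding Let_def
  proof (intro allI impI)
    fix i assume i: "i \<le> d"
    have W: "W_space s d E E' q a i = eigenspace s M (?\<kappa> i)" by (simp add: W_space_def M_def)
    \<comment> \<open>Distinct weights identify the split summands with full eigenspaces of
      \<open>K\<close> and \<open>B\<close>, which is the form that the intertwining argument
      needs.\<close>
    have "?\<kappa> j \<noteq> ?\<kappa> i" if "j \<le> d" "j \<noteq> i" for j using par(3) that i by blast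
    then have KU: "split_U s d E E' i = eigenspace s K (?\<kappa> i)"
      and BU: "split_U_Down s d E E' i = eigenspace s B (?\<kappa> i)"
      using up.eigenspace_weight_map[OF up.direct_decomposition_U i, of q]
        up.eigenspace_weight_map[OF down.direct_decomposition_U i, of q]
      by (simp_all add: U U_Down i K_weight B_weight)
    show "split_U s d E E' i = exp_q s q (\<lambda>v. s (inverse a / (q - inverse q)) (psi_map s d E E' q a v)) `
          W_space s d E E' q a i \<and>
        split_U_Down s d E E' i = exp_q s q (\<lambda>v. s (a / (q - inverse q)) (psi_map s d E E' q a v)) `
          W_space s d E E' q a i \<and>
        W_space s d E E' q a i = exp_q_inv s q
          (\<lambda>v. s (- (inverse a / (q - inverse q))) (psi_map s d E E' q a v)) ` split_U s d E E' i \<and>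
        W_space s d E E' q a i = exp_q_inv s q
          (\<lambda>v. s (- (a / (q - inverse q))) (psi_map s d E E' q a v)) ` split_U_Down s d E E' i"
      unfolding \<psi>_def[symmetric] W KU BU
      by (intro conjI up.q_exponential_eigenspaces[OF \<psi> M_endo M\<psi> K_\<psi> q roots]
          up.q_exponential_eigenspaces[OF \<psi> M_endo M\<psi> B_\<psi> q roots])
  qed
qed

end
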